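(* Let $O\subset\mathcal S_d$ be a subset invariant under inner automorphisms of $\mathcal S_d$ which contains a conjugacy class $C$ of an odd permutation $\sigma$ with $f_C\geq 2$. Then $S_O=S(\mathcal S_d,O)$ is a stable semigroup; that is, there is an element $s\in S_O$ such that $s_1\cdot s=s_2\cdot s$ for any $s_1,s_2\in S_O$ with $\alpha(s_1)=\alpha(s_2)$ and $\tau(s_1)=\tau(s_2)$.
   Context: $\mathcal S_d$ is the symmetric group acting on $I_d=\{1,\dots,d\}$; for a conjugacy class $C$ of $\sigma\in\mathcal S_d$, $f_C$ is the number of elements of $I_d$ fixed by $\sigma$. Factorization semigroups. Let $G$ be a group and $O\subset G$ a subset invariant under inner automorphisms (the pair $(G,O)$ is called an equipped group). The semigroup $S_O=S(G,O)$ is generated by the alphabet $\{x_g\mid g\in O\}$ subject to the relations $x_{g_1}\cdot x_{g_2}=x_{g_2}\cdot x_{g_2^{-1}g_1g_2}=x_{g_1g_2g_1^{-1}}\cdot x_{g_1}$ for all $g_1,g_2\in O$, and $x_{g_1}\cdot x_{\mathbf 1}=x_{g_1}$ (if $\mathbf 1\in O$). The product homomorphism $\alpha:S_O\to G$ is given by $\alpha(x_g)=g$. Let $O\setminus\{\mathbf 1\}=C_1\sqcup\dots\sqcup C_m$ be the decomposition into conjugacy classes of $G$. For $s=x_{g_1}\cdots x_{g_n}\in S_O$, the type of $s$ is $\tau(s)=n_1C_1+\dots+n_mC_m$ (an element of the free abelian semigroup generated by $C_1,\dots,C_m$), where $n_i$ is the number of factors $x_{g_j}$ with $g_j\in C_i$;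 it is well defined. *)

theory Defs
  imports "HOL-Algebra.Sym_Groups" "HOL-Library.Multiset"
begin

definition conj_class :: "('a, 'b) monoid_scheme \<Rightarrow> 'a \<Rightarrow> 'a set" where
  "conj_class G g = {h \<otimes>\<^bsub>G\<^esub> g \<otimes>\<^bsub>G\<^esub> inv\<^bsub>G\<^esub> h | h. h \<in> carrier G}"

locale equipped_group = group G for G :: "('a, 'b) monoid_scheme" (structure) +
  fixes E :: "'a set"
  assumes subset_carrier: "E \<subseteq> carrier G"
    and conj_closed: "\<lbrakk>h \<in> carrier G; g \<in> E\<rbrakk> \<Longrightarrow> h \<otimes> g \<otimes> inv h \<in> E"


section \<open>The factorization semigroup\<close>

text \<open>
  The word \<open>[g\<^sub>1, \<dots>, g\<^sub>n]\<close> stands for \<open>x\<^bsub>g\<^sub>1\<^esub> \<cdots> x\<^bsub>g\<^sub>n\<^esub>\<close>. Words are nonempty, since \<open>S(G,E)\<close> is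
  presented as a semigroup and no unit is adjoined.
\<close>

definition fs_words :: "'a set \<Rightarrow> 'a list set" where
  "fs_words E = {w. w \<noteq> [] \<and> set w \<subseteq> E}"

inductive_set fs_rel :: "('a, 'b) monoid_scheme \<Rightarrow> 'a set \<Rightarrow> ('a list \<times> 'a list) set"
  for G :: "('a, 'b) monoid_scheme" and E :: "'a set" where
  right_conj: "\<lbrakk>a \<in> E; b \<in> E\<rbrakk> \<Longrightarrow> ([a, b], [b, inv\<^bsub>G\<^esub> b \<otimes>\<^bsub>G\<^esub> a \<otimes>\<^bsub>G\<^esub> b]) \<in> fs_rel G E"
| left_conj: "\<lbrakk>a \<in> E; b \<in> E\<rbrakk> \<Longrightarrow> ([a, b], [a \<otimes>\<^bsub>G\<^esub> b \<otimes>\<^bsub>G\<^esub> inv\<^bsub>G\<^esub> a, a]) \<in> fs_rel G E"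
| absorb_one: "\<lbrakk>a \<in> E; \<one>\<^bsub>G\<^esub> \<in> E\<rbrakk> \<Longrightarrow> ([a, \<one>\<^bsub>G\<^esub>], [a]) \<in> fs_rel G E"
| refl: "w \<in> fs_words E \<Longrightarrow> (w, w) \<in> fs_rel G E"
| sym: "(u, v) \<in> fs_rel G E \<Longrightarrow> (v, u) \<in> fs_rel G E"
| trans: "\<lbrakk>(u, v) \<in> fs_rel G E; (v, w) \<in> fs_rel G E\<rbrakk> \<Longrightarrow> (u, w) \<in> fs_rel G E"
| append: "\<lbrakk>(u, u') \<in> fs_rel G E; (v, v') \<in> fs_rel G E\<rbrakk> \<Longrightarrow> (u @ v, u' @ v') \<in> fs_rel G E"

definition fact_semigroup :: "('a, 'b) monoid_scheme \<Rightarrow> 'a set \<Rightarrow> 'a list set set" where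
  "fact_semigroup G E = fs_words E // fs_rel G E"

definition fs_mult ::
    "('a, 'b) monoid_scheme \<Rightarrow> 'a set \<Rightarrow> 'a list set \<Rightarrow> 'a list set \<Rightarrow> 'a list set" where
  "fs_mult G E s t = (\<Union>u\<in>s. \<Union>v\<in>t. fs_rel G E `` {u @ v})"

definition word_prod :: "('a, 'b) monoid_scheme \<Rightarrow> 'a list \<Rightarrow> 'a" where
  "word_prod G w = foldr (\<otimes>\<^bsub>G\<^esub>) w \<one>\<^bsub>G\<^esub>"

text \<open>
  An element \<open>n\<^sub>1 C\<^sub>1 + \<dots> + n\<^sub>m C\<^sub>m\<close> of the free abelian semigroup on the conjugacy classes is
  represented as the multiset containing each \<open>C\<^sub>i\<close> with multiplicity \<open>n\<^sub>i\<close>.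
\<close>

definition word_type :: "('a, 'b) monoid_scheme \<Rightarrow> 'a list \<Rightarrow> 'a set multiset" where
  "word_type G w = image_mset (conj_class G) (filter_mset (\<lambda>g. g \<noteq> \<one>\<^bsub>G\<^esub>) (mset w))"

text \<open>
  Both \<open>word_prod G\<close> and \<open>word_type G\<close> are constant on each element of \<open>fact_semigroup G E\<close>
  (see \<open>fs_alpha_class\<close> and \<open>fs_type_class\<close> below), so the images here are singletons.
\<close>

definition fs_alpha :: "('a, 'b) monoid_scheme \<Rightarrow> 'a list set \<Rightarrow> 'a" where
  "fs_alpha G s = the_elem (word_prod G ` s)"

definition fs_type :: "('a, 'b) monoid_scheme \<Rightarrow> 'a list set \<Rightarrow> 'a set multiset" where
  "fs_type G s = the_elem (word_type G ` s)"

definition stable_fact_semigroup :: "('a, 'b) monoid_scheme \<Rightarrow> 'a set \<Rightarrow> bool" where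
  "stable_fact_semigroup G E \<longleftrightarrow>
     (\<exists>s\<in>fact_semigroup G E. \<forall>s\<^sub>1\<in>fact_semigroup G E. \<forall>s\<^sub>2\<in>fact_semigroup G E.
        fs_alpha G s\<^sub>1 = fs_alpha G s\<^sub>2 \<longrightarrow> fs_type G s\<^sub>1 = fs_type G s\<^sub>2 \<longrightarrow>
        fs_mult G E s\<^sub>1 s = fs_mult G E s\<^sub>2 s)"


section \<open>Well-definedness\<close>

lemma word_prod_Nil [simp]: "word_prod G [] = \<one>\<^bsub>G\<^esub>"
  and word_prod_Cons [simp]: "word_prod G (a # w) = a \<otimes>\<^bsub>G\<^esub> word_prod G w"
  by (simp_all add: word_prod_def)

lemma fs_words_append: "\<lbrakk>u \<in> fs_words E; v \<in> fs_words E\<rbrakk> \<Longrightarrow> u @ v \<in> fs_words E"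
  by (auto simp: fs_words_def)

lemma word_type_append: "word_type G (u @ v) = word_type G u + word_type G v"
  by (simp add: word_type_def)

context group
begin

lemma word_prod_closed: "set w \<subseteq> carrier G \<Longrightarrow> word_prod G w \<in> carrier G"
  by (induction w) auto

lemma word_prod_append:
  "\<lbrakk>set u \<subseteq> carrier G; set v \<subseteq> carrier G\<rbrakk> \<Longrightarrow>
    word_prod G (u @ v) = word_prod G u \<otimes> word_prod G v"
  by (induction u) (auto simp: word_prod_closed m_assoc)

lemma conj_class_conj:
  assumes "g \<in> carrier G" "h \<in> carrier G"
  shows "conj_class G (h \<otimes> g \<otimes> inv h) = conj_class G g"
proof
  show "conj_class G (h \<otimes> g \<otimes> inv h) \<subseteq> conj_class G g"
  proof
    fix x assume "x \<in> conj_class G (h \<otimes> g \<otimes> inv h)"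
    then obtain k where k: "k \<in> carrier G" "x = k \<otimes> (h \<otimes> g \<otimes> inv h) \<otimes> inv k"
      by (auto simp: conj_class_def)
    then have "x = (k \<otimes> h) \<otimes> g \<otimes> inv (k \<otimes> h)"
      using assms by (simp add: inv_mult_group m_assoc)
    then show "x \<in> conj_class G g"
      using k assms by (auto simp: conj_class_def)
  qed
  show "conj_class G g \<subseteq> conj_class G (h \<otimes> g \<otimes> inv h)"
  proof
    fix x assume "x \<in> conj_class G g"
    then obtain k where k: "k \<in> carrier G" "x = k \<otimes> g \<otimes> inv k"
      by (auto simp: conj_class_def)
    have "inv h \<otimes> (h \<otimes> y) = y" if "y \<in> carrier G" for y
      using that assms by (simp add: m_assoc [symmetric])
    then have "x = (k \<otimes> inv h) \<otimes> (h \<otimes> g \<otimes> inv h) \<otimes> inv (k \<otimes> inv h)"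
      using k assms by (simp add: inv_mult_group m_assoc)
    then show "x \<in> conj_class G (h \<otimes> g \<otimes> inv h)"
      unfolding conj_class_def using k assms by blast
  qed
qed

lemma conj_eq_one_iff:
  assumes "g \<in> carrier G" "h \<in> carrier G"
  shows "h \<otimes> g \<otimes> inv h = \<one> \<longleftrightarrow> g = \<one>"
proof
  assume "h \<otimes> g \<otimes> inv h = \<one>"
  then have "h \<otimes> g = h"
    using assms by (metis inv_closed inv_equality inv_inv m_closed)
  then show "g = \<one>" using assms by (simp add: r_cancel_one)
qed (use assms in simp)

lemma word_type_conj:
  assumes "g \<in> carrier G" "h \<in> carrier G"
  shows "word_type G [h \<otimes> g \<otimes> inv h] = word_type G [g]"
  using assms by (simp add: word_type_def conj_class_conj conj_eq_one_iff)

end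

context equipped_group
begin

lemma conj_closed': "\<lbrakk>h \<in> carrier G; g \<in> E\<rbrakk> \<Longrightarrow> inv h \<otimes> g \<otimes> h \<in> E"
  using conj_closed [of "inv h" g] by simp

lemma fs_rel_words: "(u, v) \<in> fs_rel G E \<Longrightarrow> u \<in> fs_words E \<and> v \<in> fs_words E"
  by (induction rule: fs_rel.induct)
    (use subset_carrier in \<open>auto simp: fs_words_def intro: conj_closed conj_closed'\<close>)

lemma equiv_fs_rel: "equiv (fs_words E) (fs_rel G E)"
proof (rule equivI)
  show "fs_rel G E \<subseteq> fs_words E \<times> fs_words E" using fs_rel_words by auto
  show "refl_on (fs_words E) (fs_rel G E)" by (auto intro: refl_onI fs_rel.refl)
  show "sym (fs_rel G E)" by (auto intro: symI fs_rel.sym)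
  show "trans (fs_rel G E)" by (auto intro: transI fs_rel.trans)
qed

lemma fs_words_carrier: "w \<in> fs_words E \<Longrightarrow> set w \<subseteq> carrier G"
  using subset_carrier by (auto simp: fs_words_def)

lemma word_prod_cong: "(u, v) \<in> fs_rel G E \<Longrightarrow> word_prod G u = word_prod G v"
proof (induction rule: fs_rel.induct)
  case (right_conj a b)
  then have "a \<in> carrier G" "b \<in> carrier G" using subset_carrier by auto
  then show ?case by (simp add: m_assoc [symmetric])
next
  case (left_conj a b)
  then have "a \<in> carrier G" "b \<in> carrier G" using subset_carrier by auto
  then show ?case by (simp add: m_assoc)
next
  case (append u u' v v')
  then show ?case using fs_rel_words fs_words_carrier by (simp add: word_prod_append)
qed (use subset_carrier in auto)

lemma word_type_cong: "(u, v) \<in> fs_rel G E \<Longrightarrow> word_type G u = word_type G v"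
proof (induction rule: fs_rel.induct)
  case (right_conj a b)
  then have "a \<in> carrier G" "b \<in> carrier G" using subset_carrier by auto
  then have "word_type G [inv b \<otimes> a \<otimes> b] = word_type G [a]"
    using word_type_conj [of a "inv b"] by simp
  then show ?case
    using word_type_append [of G "[a]" "[b]"] word_type_append [of G "[b]" "[inv b \<otimes> a \<otimes> b]"]
    by (simp add: add.commute)
next
  case (left_conj a b)
  then have "a \<in> carrier G" "b \<in> carrier G" using subset_carrier by auto
  then have "word_type G [a \<otimes> b \<otimes> inv a] = word_type G [b]"
    by (rule word_type_conj [OF _ , rotated])
  then show ?case
    using word_type_append [of G "[a]" "[b]"] word_type_append [of G "[a \<otimes> b \<otimes> inv a]" "[a]"]
    by (simp add: add.commute)
next
  case (absorb_one a)
  then show ?case by (simp add: word_type_def)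
qed (simp_all add: word_type_append)

lemma fs_mult_class:
  assumes "u \<in> fs_words E" "v \<in> fs_words E"
  shows "fs_mult G E (fs_rel G E `` {u}) (fs_rel G E `` {v}) = fs_rel G E `` {u @ v}"
  unfolding fs_mult_def
proof (rule UN_equiv_class2 [OF equiv_fs_rel equiv_fs_rel _ assms])
  show "congruent2 (fs_rel G E) (fs_rel G E) (\<lambda>x y. fs_rel G E `` {x @ y})"
    by (intro congruent2I' equiv_class_eq [OF equiv_fs_rel] fs_rel.append)
qed

lemma fs_alpha_class:
  assumes "w \<in> fs_words E"
  shows "fs_alpha G (fs_rel G E `` {w}) = word_prod G w"
proof -
  have "word_prod G ` (fs_rel G E `` {w}) = {word_prod G w}"
    using word_prod_cong fs_rel.refl [OF assms] by fastforce
  then show ?thesis by (simp add: fs_alpha_def)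
qed

lemma fs_type_class:
  assumes "w \<in> fs_words E"
  shows "fs_type G (fs_rel G E `` {w}) = word_type G w"
proof -
  have "word_type G ` (fs_rel G E `` {w}) = {word_type G w}"
    using word_type_cong fs_rel.refl [OF assms] by fastforce
  then show ?thesis by (simp add: fs_type_def)
qed

lemma fs_mult_closed:
  assumes "s \<in> fact_semigroup G E" "t \<in> fact_semigroup G E"
  shows "fs_mult G E s t \<in> fact_semigroup G E"
  using assms unfolding fact_semigroup_def
  by (auto elim!: quotientE simp: fs_mult_class fs_words_append intro!: quotientI)

lemma fs_mult_assoc:
  assumes "s \<in> fact_semigroup G E" "t \<in> fact_semigroup G E" "r \<in> fact_semigroup G E"
  shows "fs_mult G E (fs_mult G E s t) r = fs_mult G E s (fs_mult G E t r)"
  using assms unfolding fact_semigroup_def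
  by (auto elim!: quotientE simp: fs_mult_class fs_words_append)

end


section \<open>Fixed points of permutations\<close>

definition fixed_number :: "nat \<Rightarrow> (nat \<Rightarrow> nat) \<Rightarrow> nat" where
  "fixed_number d \<sigma> = card {i \<in> {1..d}. \<sigma> i = i}"

lemma fixed_number_conj_class:
  assumes "\<sigma> \<in> carrier (sym_group d)" "\<tau> \<in> conj_class (sym_group d) \<sigma>"
  shows "fixed_number d \<tau> = fixed_number d \<sigma>"
proof -
  obtain h where h: "h permutes {1..d}" and \<tau>: "\<tau> = h \<circ> \<sigma> \<circ> inv' h"
    using assms(2) by (auto simp: conj_class_def sym_group_carrier sym_group_mult)
  have "{i \<in> {1..d}. \<tau> i = i} = h ` {i \<in> {1..d}. \<sigma> i = i}"
  proof (intro Set.set_eqI iffI)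
    fix i assume i: "i \<in> {i \<in> {1..d}. \<tau> i = i}"
    have "inv' h i \<in> {1..d}"
      using i permutes_in_image [OF permutes_inv [OF h]] by blast
    moreover have "\<sigma> (inv' h i) = inv' h i"
      using i h \<tau> by (metis (mono_tags, lifting) comp_apply mem_Collect_eq permutes_inverses(2))
    ultimately show "i \<in> h ` {i \<in> {1..d}. \<sigma> i = i}"
      using permutes_inverses(1) [OF h] by (metis (mono_tags, lifting) imageI mem_Collect_eq)
  next
    fix i assume "i \<in> h ` {i \<in> {1..d}. \<sigma> i = i}"
    then obtain j where "j \<in> {1..d}" "\<sigma> j = j" "i = h j" by auto
    then show "i \<in> {i \<in> {1..d}. \<tau> i = i}"
      using permutes_in_image [OF h] permutes_inverses(2) [OF h] \<tau> by auto
  qed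
  then show ?thesis
    using permutes_inj_on [OF h] by (simp add: fixed_number_def card_image)
qed

end

theory Submission
  imports Defs "HOL-Algebra.Multiplicative_Group"
begin

text \<open>
  Let \<open>\<sigma>\<close> fix \<open>p \<noteq> q\<close>. A word of product \<open>\<one>\<close> commutes with every word, and a word
  containing every letter is a multiple of each letter. Choose a word \<open>\<tau>\<close> whose product is the
  transposition \<open>(p q)\<close> and which contains every letter of \<open>E\<close>; it exists because the products of
  words form a normal subgroup containing an odd permutation with a fixed point, and such a subgroup
  is all of \<open>S\<^sub>d\<close> (\<open>normal_subgroup_with_odd_eq_sym_group\<close>). Then \<open>s = \<tau> \<tau>\<close> is central and divisible
  by all letters, so the words modulo ``\<open>u s\<^sup>i = v s\<^sup>j\<close> for some \<open>i\<close>, \<open>j\<close>'' form a group \<open>\<Gamma>\<close>, and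
  the product map \<open>\<Gamma> \<rightarrow> S\<^sub>d\<close> is surjective with central kernel.

  The heart of the proof is that this extension splits (\<open>splitting\<close>). The class of \<open>\<tau>\<close> is an
  involution lifting \<open>(p q)\<close>. A lift of a permutation that fixes \<open>p\<close> and \<open>q\<close> commutes with it up to
  a central factor which depends only on the parity of the permutation; for the odd permutation
  \<open>\<sigma>\<close> the factor is trivial, since \<open>x\<^sub>\<sigma>\<close> commutes with \<open>\<tau>\<close>. So the factor is always trivial, and
  conjugation yields one well-defined involution above each transposition, compatibly with the
  action of \<open>S\<^sub>d\<close>. These involutions satisfy the relations needed to bring their products into a
  normal form, so they generate a copy of \<open>S\<^sub>d\<close> inside \<open>\<Gamma>\<close>. In the central extension \<open>\<Gamma>\<close>, split by
  a homomorphism \<open>F\<close>, every generator is \<open>x\<^sub>g = F(g) \<kappa>\<^sub>g\<close> with \<open>\<kappa>\<^sub>g\<close> central and depending only on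
  the conjugacy class of \<open>g\<close>. Hence product and type determine the image of a word in \<open>\<Gamma>\<close>
  (\<open>word_prod_determined_by_type\<close>).

  Consequently two words of equal product and type become equal after multiplication by a power of
  \<open>s\<close>, the same power on both sides because the types agree. To make the power uniform, only the
  finitely many words of bounded length matter: in longer words a power \<open>g\<^sup>N\<close> with \<open>g\<^sup>N = \<one>\<close> can be
  pulled out of one word and a power \<open>h\<^sup>N\<close> of a conjugate \<open>h\<close> out of the other, these two short words
  are interchangeable in the presence of \<open>s\<close>, and induction on the length applies
  (\<open>stable_if_group_determined\<close>).
\<close>


section \<open>Transpositions and normal subgroups of symmetric groups\<close>

abbreviation transposition :: "'s \<Rightarrow> 's \<Rightarrow> 's \<Rightarrow> 's" where
  "transposition \<equiv> Transposition.transpose"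

lemma exists_permutes_pair:
  assumes "a \<in> S" "b \<in> S" "a \<noteq> b" "a' \<in> S" "b' \<in> S" "a' \<noteq> b'"
  obtains h where "h permutes S" "h a = a'" "h b = b'"
proof
  let ?b = "transposition a a' b"
  let ?h = "transposition ?b b' \<circ> transposition a a'"
  have "?b \<in> S" using assms by (auto simp: Transposition.transpose_def)
  then show "?h permutes S"
    using assms by (intro permutes_compose permutes_swap_id) auto
  have "?b \<noteq> a'" using assms by (auto simp: Transposition.transpose_def)
  then show "?h a = a'" "?h b = b'" using assms by auto
qed

lemma conj_transposition:
  assumes "h permutes S"
  shows "h \<circ> transposition a b \<circ> inv' h = transposition (h a) (h b)"
proof -
  have "bij h" using assms by (rule permutes_bij)
  then have "transposition (h a) (h b) \<circ> h = h \<circ> transposition a b"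
    by (simp add: transpose_comp_eq bij_is_inj)
  then have "h \<circ> transposition a b \<circ> inv' h = transposition (h a) (h b) \<circ> (h \<circ> inv' h)"
    by (simp add: o_assoc)
  then show ?thesis using permutes_inv_o(1)[OF assms] by simp
qed

lemma exists_permutes_triple:
  assumes "distinct [a, b, c]" "{a, b, c} \<subseteq> S" "distinct [a', b', c']" "{a', b', c'} \<subseteq> S"
  obtains h where "h permutes S" "h a = a'" "h b = b'" "h c = c'"
proof -
  obtain k where k: "k permutes S" "k a = a'" "k b = b'"
    using exists_permutes_pair[of a S b a' b'] assms by auto
  have "k c \<in> S" using k(1) assms by (simp add: permutes_in_image)
  moreover have "k c \<noteq> a'" "k c \<noteq> b'"
    using k assms permutes_inj[OF k(1)] by (auto simp: inj_eq dest!: sym)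
  ultimately show ?thesis
    using k assms
    by (intro that[of "transposition (k c) c' \<circ> k"] permutes_compose permutes_swap_id) auto
qed

text \<open>
  If \<open>\<sigma>\<close> fixes \<open>p\<close> and moves \<open>a\<close> to \<open>b\<close>, then the commutator of \<open>\<sigma>\<close> and \<open>(p a)\<close> is
  \<open>(p b) (p a)\<close>, a 3-cycle. Its conjugates are the products of two distinct transpositions with a
  common point; chaining these, all transpositions lie in one coset of \<open>H\<close>, so \<open>H\<close> contains the
  even permutations, and the odd element \<open>\<sigma>\<close> supplies the rest.
\<close>

lemma normal_subgroup_with_odd_eq_sym_group:
  assumes normal: "normal H (sym_group d)"
    and \<sigma>: "\<sigma> \<in> H" "\<not> evenperm \<sigma>" and p: "p \<in> {1..d}" "\<sigma> p = p"
  shows "H = carrier (sym_group d)"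
proof -
  interpret normal H "sym_group d" by (rule normal)
  note sub = normal_imp_subgroup[OF normal]
  let ?S = "{1..d}"
  have H_perm: "h permutes ?S" if "h \<in> H" for h
    using that subgroup.subset[OF sub] by (auto simp: sym_group_carrier)
  have H_comp: "g \<circ> h \<in> H" if "g \<in> H" "h \<in> H" for g h
    using subgroup.m_closed[OF sub] that by (simp add: sym_group_mult)
  have H_inv: "inv' h \<in> H" if "h \<in> H" for h
    using subgroup.m_inv_closed[OF sub that] that subgroup.subset[OF sub] by auto
  have H_conj: "h \<circ> g \<circ> inv' h \<in> H" if "g \<in> H" "h permutes ?S" for g h
    using inv_op_closed2[of h g] that by (simp add: sym_group_mult sym_group_carrier)
  have H_conj': "inv' h \<circ> g \<circ> h \<in> H" if "g \<in> H" "h permutes ?S" for g h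
    using inv_op_closed1[of h g] that by (simp add: sym_group_mult sym_group_carrier)
  have id_H: "id \<in> H" using subgroup.one_closed[OF sub] by (simp add: sym_group_one)
  have \<sigma>S: "\<sigma> permutes ?S" using \<sigma> H_perm by blast
  have "\<sigma> \<noteq> id" using \<sigma>(2) by auto
  then obtain a where a: "\<sigma> a \<noteq> a" by (auto simp: fun_eq_iff)
  let ?b = "\<sigma> a"
  have aS: "a \<in> ?S" using a \<sigma>S by (meson permutes_not_in)
  have bS: "?b \<in> ?S" using aS permutes_in_image[OF \<sigma>S] by blast
  have ne: "a \<noteq> p" "?b \<noteq> p" "?b \<noteq> a"
    using a p(2) permutes_inj[OF \<sigma>S] by (auto simp: inj_eq dest: injD[of \<sigma> a p])
  have three_cycle: "transposition p ?b \<circ> transposition p a \<in> H"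
  proof -
    have t: "transposition p a permutes ?S" using aS p by (intro permutes_swap_id)
    have "\<sigma> \<circ> (inv' (transposition p a) \<circ> inv' \<sigma> \<circ> transposition p a) \<in> H"
      using \<sigma> t by (intro H_comp H_conj' H_inv)
    moreover have "\<sigma> \<circ> (inv' (transposition p a) \<circ> inv' \<sigma> \<circ> transposition p a) =
        (\<sigma> \<circ> transposition p a \<circ> inv' \<sigma>) \<circ> transposition p a"
      by (simp add: o_assoc)
    ultimately show ?thesis using conj_transposition[OF \<sigma>S, of p a] p by simp
  qed
  have share: "transposition x y \<circ> transposition x z \<in> H"
    if xyz: "x \<in> ?S" "y \<in> ?S" "z \<in> ?S" "x \<noteq> y" "x \<noteq> z" for x y z
  proof (cases "y = z")
    case True
    then show ?thesis using id_H by simp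
  next
    case False
    then obtain h where h: "h permutes ?S" "h p = x" "h ?b = y" "h a = z"
      using exists_permutes_triple[of p ?b a ?S x y z] xyz ne aS bS p by auto
    have "transposition x y \<circ> transposition x z =
        (h \<circ> transposition p ?b \<circ> inv' h) \<circ> (h \<circ> transposition p a \<circ> inv' h)"
      using h conj_transposition[OF h(1)] by simp
    also have "\<dots> = h \<circ> transposition p ?b \<circ> (inv' h \<circ> h) \<circ> transposition p a \<circ> inv' h"
      by (simp only: o_assoc)
    also have "\<dots> = h \<circ> (transposition p ?b \<circ> transposition p a) \<circ> inv' h"
      using permutes_inv_o(2)[OF h(1)] by (simp add: o_assoc)
    finally show ?thesis using H_conj[OF three_cycle h(1)] by simp
  qed
  have chain: "f \<circ> k \<in> H" if "f \<circ> transposition x y \<in> H" "transposition x y \<circ> k \<in> H"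
    for f k and x y :: nat
  proof -
    have "(f \<circ> transposition x y) \<circ> (transposition x y \<circ> k) = f \<circ> (transposition x y \<circ> transposition x y) \<circ> k"
      by (simp only: o_assoc)
    then show ?thesis using H_comp[OF that] by simp
  qed
  have pair: "transposition x y \<circ> transposition x' y' \<in> H"
    if "x \<in> ?S" "y \<in> ?S" "x' \<in> ?S" "y' \<in> ?S" "x \<noteq> y" "x' \<noteq> y'" for x y x' y'
  proof (cases "x = y'")
    case True
    then show ?thesis using share[of x y x'] that by (simp add: transpose_commute)
  next
    case False
    have "transposition x y' \<circ> transposition x' y' \<in> H"
      using share[of y' x x'] that False by (simp add: transpose_commute)
    then show ?thesis using share[of x y y'] that False chain by blast
  qed
  let ?t = "transposition p a"
  have parity: "if evenperm h then h \<in> H else ?t \<circ> h \<in> H" if "h permutes ?S" for h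
    using that finite_atLeastAtMost
  proof (induction rule: permutes_induct)
    case id
    show ?case using id_H by simp
  next
    case (swap x y h)
    have "permutation h" using swap.hyps(4) permutation_permutes by blast
    then have flip: "evenperm (transposition x y \<circ> h) \<longleftrightarrow> \<not> evenperm h"
      using swap.hyps(3) by (subst evenperm_comp) (simp_all add: permutation_swap_id evenperm_swap)
    show ?case
    proof (cases "evenperm h")
      case True
      then have "(?t \<circ> transposition x y) \<circ> h \<in> H"
        using swap aS p ne by (intro H_comp pair) auto
      then show ?thesis using True flip by (simp add: o_def)
    next
      case False
      then have "?t \<circ> h \<in> H" using swap.IH by simp
      moreover have "transposition x y \<circ> ?t \<in> H" using swap aS p ne by (intro pair) auto
      ultimately have "transposition x y \<circ> h \<in> H" using chain by blast
      then show ?thesis using False flip by (simp add: o_def)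
    qed
  qed
  \<comment> \<open>Both \<open>\<sigma>\<close> and \<open>?t \<circ> \<sigma>\<close> lie in \<open>H\<close>, the latter because \<open>\<sigma>\<close> is odd.\<close>
  have "(?t \<circ> \<sigma>) \<circ> inv' \<sigma> \<in> H" using parity[OF \<sigma>S] \<sigma> H_inv H_comp by auto
  moreover have "(?t \<circ> \<sigma>) \<circ> inv' \<sigma> = ?t \<circ> (\<sigma> \<circ> inv' \<sigma>)" by (simp only: o_assoc)
  ultimately have tH: "?t \<in> H" using permutes_inv_o(1)[OF \<sigma>S] by simp
  have "h \<in> H" if "h permutes ?S" for h
  proof (cases "evenperm h")
    case True
    then show ?thesis using parity[OF that] by simp
  next
    case False
    then have "?t \<circ> (?t \<circ> h) \<in> H" using parity[OF that] tH H_comp by simp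
    moreover have "?t \<circ> (?t \<circ> h) = (?t \<circ> ?t) \<circ> h" by (simp only: o_assoc)
    ultimately show ?thesis by simp
  qed
  then show ?thesis using subgroup.subset[OF sub] by (auto simp: sym_group_carrier)
qed


section \<open>Central extensions of a symmetric group\<close>

context group
begin

definition conj_by :: "'a \<Rightarrow> 'a \<Rightarrow> 'a" where "conj_by x t = x \<otimes> t \<otimes> inv x"

lemma conj_by_closed [simp]: "\<lbrakk>x \<in> carrier G; t \<in> carrier G\<rbrakk> \<Longrightarrow> conj_by x t \<in> carrier G"
  by (simp add: conj_by_def)

lemma inv_mult_cancel [simp]: "\<lbrakk>x \<in> carrier G; y \<in> carrier G\<rbrakk> \<Longrightarrow> inv x \<otimes> (x \<otimes> y) = y"
  by (simp add: m_assoc [symmetric])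

lemma mult_inv_cancel [simp]: "\<lbrakk>x \<in> carrier G; y \<in> carrier G\<rbrakk> \<Longrightarrow> x \<otimes> (inv x \<otimes> y) = y"
  by (simp add: m_assoc [symmetric])

lemma conj_by_conj_by:
  "\<lbrakk>x \<in> carrier G; y \<in> carrier G; t \<in> carrier G\<rbrakk> \<Longrightarrow> conj_by x (conj_by y t) = conj_by (x \<otimes> y) t"
  by (simp add: conj_by_def m_assoc inv_mult_group)

lemma conj_by_mult:
  "\<lbrakk>x \<in> carrier G; t \<in> carrier G; u \<in> carrier G\<rbrakk> \<Longrightarrow> conj_by x (t \<otimes> u) = conj_by x t \<otimes> conj_by x u"
  by (simp add: conj_by_def m_assoc)

lemma conj_by_one [simp]: "x \<in> carrier G \<Longrightarrow> conj_by x \<one> = \<one>" "t \<in> carrier G \<Longrightarrow> conj_by \<one> t = t"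
  by (simp_all add: conj_by_def)

lemma conj_by_eq_self:
  "\<lbrakk>x \<otimes> t = t \<otimes> x; x \<in> carrier G; t \<in> carrier G\<rbrakk> \<Longrightarrow> conj_by x t = t"
  by (simp add: conj_by_def m_assoc)

lemma conj_by_commute: "\<lbrakk>x \<in> carrier G; t \<in> carrier G\<rbrakk> \<Longrightarrow> x \<otimes> t = conj_by x t \<otimes> x"
  by (simp add: conj_by_def m_assoc)

end

text \<open>
  A central extension of the symmetric group on \<open>S\<close>. Permutations are kept as functions rather
  than as elements of \<open>sym_group\<close>, so that the support can shrink in the inductions below.
\<close>

locale perm_extension = group G for G :: "('a, 'b) monoid_scheme" (structure) +
  fixes \<pi> :: "'a \<Rightarrow> 's \<Rightarrow> 's" and S :: "'s set"
  assumes finite_S: "finite S"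
    and \<pi>_permutes: "x \<in> carrier G \<Longrightarrow> \<pi> x permutes S"
    and \<pi>_mult: "\<lbrakk>x \<in> carrier G; y \<in> carrier G\<rbrakk> \<Longrightarrow> \<pi> (x \<otimes> y) = \<pi> x \<circ> \<pi> y"
    and \<pi>_surj: "h permutes S \<Longrightarrow> \<exists>x\<in>carrier G. \<pi> x = h"
    and ker_central: "\<lbrakk>x \<in> carrier G; \<pi> x = id; y \<in> carrier G\<rbrakk> \<Longrightarrow> x \<otimes> y = y \<otimes> x"
begin

lemma \<pi>_one [simp]: "\<pi> \<one> = id"
proof -
  have "\<pi> \<one> \<circ> \<pi> \<one> = \<pi> \<one>" using \<pi>_mult[of \<one> \<one>] by simp
  then have "inv' (\<pi> \<one>) \<circ> (\<pi> \<one> \<circ> \<pi> \<one>) = inv' (\<pi> \<one>) \<circ> \<pi> \<one>" by simp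
  then show ?thesis using permutes_inv_o(2)[OF \<pi>_permutes[of \<one>]] by (simp add: o_assoc)
qed

lemma \<pi>_inv: assumes "x \<in> carrier G" shows "\<pi> (inv x) = inv' (\<pi> x)"
proof -
  have "\<pi> (inv x) \<circ> \<pi> x = id" using \<pi>_mult[of "inv x" x] assms by simp
  then have "\<pi> (inv x) \<circ> (\<pi> x \<circ> inv' (\<pi> x)) = inv' (\<pi> x)" by (simp add: o_assoc)
  then show ?thesis using permutes_inv_o(1)[OF \<pi>_permutes[OF assms]] by simp
qed

lemma \<pi>_conj_by:
  "\<lbrakk>x \<in> carrier G; t \<in> carrier G\<rbrakk> \<Longrightarrow> \<pi> (conj_by x t) = \<pi> x \<circ> \<pi> t \<circ> inv' (\<pi> x)"
  by (simp add: conj_by_def \<pi>_mult \<pi>_inv)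

lemma conj_by_ker: "\<lbrakk>x \<in> carrier G; \<pi> t = id; t \<in> carrier G\<rbrakk> \<Longrightarrow> conj_by x t = t"
  using ker_central[of t x] by (simp add: conj_by_eq_self)

text \<open>
  Since the kernel is central, conjugation by \<open>x\<close> depends only on \<open>\<pi> x\<close>: the symmetric group
  acts on its central extension.
\<close>

lemma conj_by_eq_of_\<pi>_eq:
  assumes "x \<in> carrier G" "y \<in> carrier G" "t \<in> carrier G" "\<pi> x = \<pi> y"
  shows "conj_by x t = conj_by y t"
proof -
  have "\<pi> (inv y \<otimes> x) = id"
    using assms permutes_inv_o(2)[OF \<pi>_permutes] by (simp add: \<pi>_mult \<pi>_inv)
  then have "conj_by (inv y \<otimes> x) t = t" using assms ker_central by (intro conj_by_eq_self) auto
  then have "conj_by y t = conj_by y (conj_by (inv y \<otimes> x) t)" by simp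
  then show ?thesis using assms by (simp add: conj_by_conj_by)
qed

lemma \<pi>_eqD:
  assumes "x \<in> carrier G" "y \<in> carrier G" "\<pi> x = \<pi> y"
  obtains z where "z \<in> carrier G" "\<pi> z = id" "x = z \<otimes> y"
proof
  show "x \<otimes> inv y \<in> carrier G" "x = x \<otimes> inv y \<otimes> y" using assms by (simp_all add: m_assoc)
  show "\<pi> (x \<otimes> inv y) = id"
    using assms permutes_inv_o(1)[OF \<pi>_permutes] by (simp add: \<pi>_mult \<pi>_inv)
qed

end

text \<open>
  An involution \<open>T0\<close> above the transposition \<open>(p q)\<close>, together with an element \<open>y\<close> above an odd
  permutation fixing \<open>p\<close> and \<open>q\<close> that commutes with \<open>T0\<close>. The element \<open>y\<close> kills the obstruction
  to splitting: in a double cover of a symmetric group in which lifts of disjoint transpositions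
  anticommute, lifts of disjoint odd permutations anticommute as well, and no such \<open>y\<close> exists.
\<close>

locale marked_perm_extension = perm_extension +
  fixes p q :: 's and T0 y :: 'a
  assumes pq: "p \<in> S" "q \<in> S" "p \<noteq> q"
    and T0: "T0 \<in> carrier G" "\<pi> T0 = transposition p q" "T0 \<otimes> T0 = \<one>"
    and y: "y \<in> carrier G" "y \<otimes> T0 = T0 \<otimes> y" "\<pi> y p = p" "\<pi> y q = q" "\<not> evenperm (\<pi> y)"
begin

lemma \<pi>_conj_by_T0: "x \<in> carrier G \<Longrightarrow> \<pi> (conj_by x T0) = transposition (\<pi> x p) (\<pi> x q)"
  using T0 by (simp add: \<pi>_conj_by conj_transposition[OF \<pi>_permutes])

text \<open>
  For \<open>x\<close> above a permutation of \<open>S - {p, q}\<close>, conjugation by \<open>x\<close> multiplies \<open>T0\<close> by a central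
  factor, multiplicatively in \<open>x\<close>. All transpositions of \<open>S - {p, q}\<close> are conjugate there and so
  give the same factor \<open>\<zeta>\<close>, and \<open>\<zeta>\<^sup>2 = \<one>\<close> because \<open>T0\<close> is an involution. So the factor is \<open>\<one>\<close> or \<open>\<zeta>\<close>
  according to parity, and the odd element \<open>y\<close>, which commutes with \<open>T0\<close>, forces \<open>\<zeta> = \<one>\<close>.
\<close>

lemma conj_by_T0_fix:
  assumes "x \<in> carrier G" "\<pi> x p = p" "\<pi> x q = q"
  shows "conj_by x T0 = T0"
proof -
  define D where "D = S - {p, q}"
  have fixD: "h permutes D" if "h permutes S" "h p = p" "h q = q" for h
    using that(1) by (rule permutes_superset) (use that in \<open>auto simp: D_def\<close>)
  have Dfix: "h permutes S" "h p = p" "h q = q" if "h permutes D" for h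
  proof -
    show "h permutes S" using that by (rule permutes_subset) (auto simp: D_def)
    show "h p = p" "h q = q" using that by (simp_all add: permutes_not_in D_def)
  qed
  have finD: "finite D" using finite_S D_def by simp
  have piyD: "\<pi> y permutes D" using y by (intro fixD \<pi>_permutes)
  have "\<pi> y \<noteq> id" using y by auto
  then obtain a where "\<pi> y a \<noteq> a" by (auto simp: fun_eq_iff)
  moreover from this have "a \<in> D" using piyD by (meson permutes_not_in)
  moreover from this have "\<pi> y a \<in> D" using piyD by (simp add: permutes_in_image)
  ultimately obtain b where ab: "a \<in> D" "b \<in> D" "a \<noteq> b" by metis
  then have "transposition a b permutes D" by (simp add: permutes_swap_id)
  then obtain e where e: "e \<in> carrier G" "\<pi> e = transposition a b" using Dfix \<pi>_surj by metis
  have lift: "\<exists>z\<in>carrier G. \<pi> z = id \<and> conj_by x T0 = z \<otimes> T0"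
    if "x \<in> carrier G" "\<pi> x permutes D" for x
  proof -
    have "\<pi> (conj_by x T0) = \<pi> T0" using \<pi>_conj_by_T0[of x] that Dfix[of "\<pi> x"] T0 by simp
    then show ?thesis using \<pi>_eqD[of "conj_by x T0" T0] that T0 by (metis conj_by_closed)
  qed
  then obtain \<zeta> where \<zeta>: "\<zeta> \<in> carrier G" "\<pi> \<zeta> = id" "conj_by e T0 = \<zeta> \<otimes> T0"
    using e \<open>transposition a b permutes D\<close> by metis
  have "conj_by e T0 \<otimes> conj_by e T0 = \<one>" using e T0 by (simp flip: conj_by_mult)
  moreover have "\<zeta> \<otimes> T0 \<otimes> (\<zeta> \<otimes> T0) = \<zeta> \<otimes> \<zeta> \<otimes> (T0 \<otimes> T0)"
    using \<zeta> T0 ker_central[of \<zeta> T0] by (metis m_assoc m_closed)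
  ultimately have \<zeta>2: "\<zeta> \<otimes> \<zeta> = \<one>" using \<zeta> T0 by simp
  have transposition_case: "conj_by x T0 = \<zeta> \<otimes> T0"
    if x: "x \<in> carrier G" "\<pi> x = transposition c f" and cf: "c \<in> D" "f \<in> D" "c \<noteq> f" for x c f
  proof -
    obtain h where h: "h permutes D" "h a = c" "h b = f"
      using exists_permutes_pair ab cf by metis
    then obtain r where r: "r \<in> carrier G" "\<pi> r = h" using Dfix \<pi>_surj by metis
    have ir: "\<pi> (inv r) permutes D" using r h \<pi>_inv permutes_inv by metis
    obtain z where z: "z \<in> carrier G" "\<pi> z = id" "conj_by (inv r) T0 = z \<otimes> T0"
      using lift ir r by (metis inv_closed)
    have "conj_by r (conj_by (inv r) T0) = T0" using r T0 by (simp add: conj_by_conj_by)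
    then have zr: "z \<otimes> conj_by r T0 = T0" using z r T0 by (simp add: conj_by_mult conj_by_ker)
    have "\<pi> (r \<otimes> e \<otimes> inv r) = \<pi> x"
      using r e x h Dfix[of h] by (simp add: \<pi>_mult \<pi>_inv conj_transposition)
    then have "conj_by x T0 = conj_by (r \<otimes> e \<otimes> inv r) T0"
      using x r e T0 by (intro conj_by_eq_of_\<pi>_eq) auto
    also have "\<dots> = conj_by r (conj_by e (conj_by (inv r) T0))"
      using r e T0 by (simp add: conj_by_conj_by m_assoc)
    also have "\<dots> = z \<otimes> (\<zeta> \<otimes> conj_by r T0)"
      using r e z T0 \<zeta> by (simp add: conj_by_mult conj_by_ker)
    also have "\<dots> = \<zeta> \<otimes> (z \<otimes> conj_by r T0)"
      using ker_central[of \<zeta> z] \<zeta> z r T0 by (simp flip: m_assoc)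
    finally show ?thesis using zr by simp
  qed
  have "conj_by x T0 = (if evenperm h then T0 else \<zeta> \<otimes> T0)"
    if "h permutes D" "x \<in> carrier G" "\<pi> x = h" for h x
    using that(1) finD that(2,3)
  proof (induction arbitrary: x rule: permutes_induct)
    case id
    then show ?case using T0 ker_central[of x T0] by (simp add: conj_by_eq_self flip: id_def)
  next
    case (swap c f h)
    have "transposition c f permutes S" using swap Dfix by (metis permutes_swap_id)
    then obtain w where w: "w \<in> carrier G" "\<pi> w = transposition c f" using \<pi>_surj by metis
    have "\<pi> (inv w \<otimes> x) = inv' (\<pi> w) \<circ> (\<pi> w \<circ> h)"
      using swap.prems w by (simp add: \<pi>_mult \<pi>_inv o_def)
    also have "\<dots> = h"
      using permutes_inv_o(2)[OF \<pi>_permutes[OF w(1)]] by (simp add: o_assoc del: comp_apply)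
    finally have "\<pi> (inv w \<otimes> x) = h" .
    then have IH: "conj_by (inv w \<otimes> x) T0 = (if evenperm h then T0 else \<zeta> \<otimes> T0)"
      using swap.IH swap.prems w by simp
    have "conj_by x T0 = conj_by w (conj_by (inv w \<otimes> x) T0)"
      using swap.prems w T0 by (simp add: conj_by_conj_by)
    also have "\<dots> = (if evenperm h then \<zeta> \<otimes> T0 else T0)"
      using IH transposition_case[OF w swap.hyps(1-3)] w \<zeta> T0 \<zeta>2
      by (simp add: conj_by_mult conj_by_ker flip: m_assoc)
    moreover have "permutation h" using swap finD permutation_permutes by blast
    then have "evenperm (transposition c f \<circ> h) \<longleftrightarrow> \<not> evenperm h"
      using swap.hyps(3) by (subst evenperm_comp) (simp_all add: permutation_swap_id evenperm_swap)
    ultimately show ?case by (simp add: o_def)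
  qed note parity = this
  have "conj_by y T0 = T0" using y T0 by (simp add: conj_by_eq_self)
  then have "\<zeta> \<otimes> T0 = T0" using parity[OF piyD] y by simp
  then have "\<zeta> = \<one>" using \<zeta> T0 by simp
  then show ?thesis using parity[of "\<pi> x" x] fixD[of "\<pi> x"] \<pi>_permutes[of x] assms T0 by simp
qed

text \<open>
  The lift of the transposition \<open>(a b)\<close> obtained by conjugating \<open>T0\<close>; by \<open>conj_by_T0_fix\<close> the
  conjugating element does not matter.
\<close>

definition T :: "'s \<Rightarrow> 's \<Rightarrow> 'a" where
  "T a b = conj_by (SOME x. x \<in> carrier G \<and> \<pi> x p = a \<and> \<pi> x q = b) T0"

lemma T_eq_conj_by:
  assumes "x \<in> carrier G" "\<pi> x p = a" "\<pi> x q = b"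
  shows "T a b = conj_by x T0"
proof -
  define r where "r = (SOME x. x \<in> carrier G \<and> \<pi> x p = a \<and> \<pi> x q = b)"
  have r: "r \<in> carrier G \<and> \<pi> r p = a \<and> \<pi> r q = b"
    unfolding r_def by (rule someI[of _ x]) (use assms in auto)
  have "inv' (\<pi> x) a = p" "inv' (\<pi> x) b = q"
    using assms permutes_inverses(2)[OF \<pi>_permutes[of x]] by auto
  then have "\<pi> (inv x \<otimes> r) p = p" "\<pi> (inv x \<otimes> r) q = q"
    using r assms by (auto simp: \<pi>_mult \<pi>_inv)
  then have "conj_by (inv x \<otimes> r) T0 = T0" using r assms by (intro conj_by_T0_fix) auto
  then have "conj_by x T0 = conj_by x (conj_by (inv x \<otimes> r) T0)" by simp
  then show ?thesis using r assms T0 by (simp add: conj_by_conj_by T_def flip: r_def)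
qed

lemma T_obtain:
  assumes "a \<in> S" "b \<in> S" "a \<noteq> b"
  obtains x where "x \<in> carrier G" "\<pi> x p = a" "\<pi> x q = b" "T a b = conj_by x T0"
proof -
  obtain h where h: "h permutes S" "h p = a" "h q = b"
    using exists_permutes_pair[OF pq assms] by blast
  then obtain x where "x \<in> carrier G" "\<pi> x = h" using \<pi>_surj by metis
  then show ?thesis using that h T_eq_conj_by by blast
qed

lemma T_closed: "\<lbrakk>a \<in> S; b \<in> S; a \<noteq> b\<rbrakk> \<Longrightarrow> T a b \<in> carrier G"
  by (metis T_obtain conj_by_closed T0(1))

lemma \<pi>_T: "\<lbrakk>a \<in> S; b \<in> S; a \<noteq> b\<rbrakk> \<Longrightarrow> \<pi> (T a b) = transposition a b"
  by (metis T_obtain \<pi>_conj_by_T0)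

lemma T_square: "\<lbrakk>a \<in> S; b \<in> S; a \<noteq> b\<rbrakk> \<Longrightarrow> T a b \<otimes> T a b = \<one>"
proof (elim T_obtain[of a b])
  fix x assume x: "x \<in> carrier G" "T a b = conj_by x T0"
  then have "T a b \<otimes> T a b = conj_by x (T0 \<otimes> T0)" using T0(1) by (simp add: conj_by_mult)
  then show "T a b \<otimes> T a b = \<one>" using x T0 by simp
qed

lemma T_commute: "\<lbrakk>a \<in> S; b \<in> S; a \<noteq> b\<rbrakk> \<Longrightarrow> T a b = T b a"
proof (elim T_obtain[of a b])
  fix x assume x: "x \<in> carrier G" "\<pi> x p = a" "\<pi> x q = b" "T a b = conj_by x T0"
  have "T b a = conj_by (x \<otimes> T0) T0"
    by (rule T_eq_conj_by) (use x T0 in \<open>auto simp: \<pi>_mult\<close>)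
  also have "\<dots> = conj_by x (conj_by T0 T0)" using x T0 by (simp add: conj_by_conj_by)
  finally show "T a b = T b a" using x T0 by (simp add: conj_by_eq_self)
qed

lemma conj_by_T:
  assumes "a \<in> S" "b \<in> S" "a \<noteq> b" "g \<in> carrier G"
  shows "conj_by g (T a b) = T (\<pi> g a) (\<pi> g b)"
proof -
  obtain x where x: "x \<in> carrier G" "\<pi> x p = a" "\<pi> x q = b" "T a b = conj_by x T0"
    using T_obtain assms by blast
  have "T (\<pi> g a) (\<pi> g b) = conj_by (g \<otimes> x) T0"
    by (rule T_eq_conj_by) (use x assms in \<open>auto simp: \<pi>_mult\<close>)
  then show ?thesis using x assms T0 by (simp add: conj_by_conj_by)
qed

text \<open>
  Conjugation among the lifts mirrors conjugation among the transpositions. Together with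
  \<open>T_square\<close> and \<open>T_commute\<close> this is all that is used about products of the lifts.
\<close>

lemma T_T:
  assumes "a \<in> S" "b \<in> S" "a \<noteq> b" "c \<in> S" "e \<in> S" "c \<noteq> e"
  shows "T a b \<otimes> T c e = T (transposition a b c) (transposition a b e) \<otimes> T a b"
  using assms conj_by_commute[of "T a b" "T c e"] by (simp add: T_closed conj_by_T \<pi>_T)

definition Ts :: "'s set \<Rightarrow> 'a set" where
  "Ts A = {T a b |a b. a \<in> A \<and> b \<in> A \<and> a \<noteq> b}"

lemma TsI: "\<lbrakk>a \<in> A; b \<in> A; a \<noteq> b\<rbrakk> \<Longrightarrow> T a b \<in> Ts A"
  by (auto simp: Ts_def)

lemma Ts_carrier: "A \<subseteq> S \<Longrightarrow> Ts A \<subseteq> carrier G"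
  by (auto simp: Ts_def T_closed subset_iff)

text \<open>
  The analogue, for lifts, of writing a permutation of \<open>insert n A\<close> as \<open>(n a)\<close> times a permutation
  of \<open>A\<close>: lifts that involve \<open>n\<close> are moved to the front, where two of them merge by
  \<open>T n e \<otimes> T n a = T n a \<otimes> T a e\<close> if \<open>a \<noteq> e\<close>, and cancel if \<open>a = e\<close>.
\<close>

lemma Ts_prod_normal_form:
  assumes "insert n A \<subseteq> S" "n \<notin> A" "set ts \<subseteq> Ts (insert n A)"
  shows "\<exists>us. set us \<subseteq> Ts A \<and>
    (word_prod G ts = word_prod G us \<or> (\<exists>a\<in>A. word_prod G ts = T n a \<otimes> word_prod G us))"
  using assms(3)
proof (induction ts)
  case Nil
  show ?case by (rule exI[of _ "[]"]) simp
next
  case (Cons t ts)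
  then obtain us where us: "set us \<subseteq> Ts A"
    "word_prod G ts = word_prod G us \<or> (\<exists>a\<in>A. word_prod G ts = T n a \<otimes> word_prod G us)" by auto
  have usG: "word_prod G us \<in> carrier G"
    using us Ts_carrier[of A] assms by (intro word_prod_closed) auto
  have inS: "x \<in> S" if "x \<in> A \<or> x = n" for x using that assms by auto
  from Cons.prems consider c e where "c \<in> A" "e \<in> A" "c \<noteq> e" "t = T c e"
    | e where "e \<in> A" "t = T n e"
    by (auto simp: Ts_def) (metis T_commute inS)+
  then show ?case
  proof cases
    case 1
    from us(2) show ?thesis
    proof (elim disjE bexE)
      assume "word_prod G ts = word_prod G us"
      then show ?thesis using 1 us by (intro exI[of _ "t # us"]) (auto intro: TsI)
    next
      fix a assume a: "a \<in> A" "word_prod G ts = T n a \<otimes> word_prod G us"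
      let ?a = "transposition c e a"
      have aA: "?a \<in> A" using a 1 by (auto simp: Transposition.transpose_def)
      have ne: "n \<noteq> a" "n \<noteq> c" "n \<noteq> e" "n \<noteq> ?a" using a 1 aA assms by auto
      have "t \<otimes> word_prod G ts = T n ?a \<otimes> word_prod G (t # us)"
        using a 1 usG aA ne inS T_T[of c e n a]
        by (simp add: T_closed flip: m_assoc)
      then show ?thesis
        using 1 us aA by (intro exI[of _ "t # us"]) (auto intro: TsI)
    qed
  next
    case 2
    then have ne: "n \<noteq> e" using assms by auto
    from us(2) show ?thesis
    proof (elim disjE bexE)
      assume "word_prod G ts = word_prod G us"
      then show ?thesis using 2 us by (intro exI[of _ us]) auto
    next
      fix a assume a: "a \<in> A" "word_prod G ts = T n a \<otimes> word_prod G us"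
      then have na: "n \<noteq> a" using assms by auto
      show ?thesis
      proof (cases "a = e")
        case True
        then have "t \<otimes> word_prod G ts = word_prod G us"
          using a 2 usG ne inS T_square[of n e] by (simp add: T_closed flip: m_assoc)
        then show ?thesis using us by (intro exI[of _ us]) auto
      next
        case False
        have "T n a \<otimes> T a e = T n e \<otimes> T n a"
          using T_T[of n a a e] a 2 na ne False inS by simp
        then have "t \<otimes> word_prod G ts = T n a \<otimes> word_prod G (T a e # us)"
          using a 2 usG ne na False inS by (simp add: T_closed flip: m_assoc)
        then show ?thesis
          using a 2 us False by (intro exI[of _ "T a e # us"]) (auto intro: TsI)
      qed
    qed
  qed
qed

lemma \<pi>_Ts_prod_permutes:
  assumes "A \<subseteq> S" "set ts \<subseteq> Ts A"
  shows "\<pi> (word_prod G ts) permutes A"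
  using assms(2)
proof (induction ts)
  case (Cons t ts)
  obtain a b where t: "a \<in> A" "b \<in> A" "a \<noteq> b" "t = T a b"
    using Cons.prems by (auto simp: Ts_def)
  have "\<pi> (word_prod G (t # ts)) = transposition a b \<circ> \<pi> (word_prod G ts)"
    using t Cons.prems assms Ts_carrier[OF assms(1)]
    by (simp add: \<pi>_mult T_closed word_prod_closed subset_iff \<pi>_T)
  moreover have "\<pi> (word_prod G ts) permutes A" using Cons by simp
  ultimately show ?case using t by (metis permutes_compose permutes_swap_id)
qed simp

text \<open>
  No relation is lost on lifting. In the normal form of a product with trivial image the factor
  \<open>T n a\<close> cannot occur, since the image would map \<open>n\<close> to \<open>a\<close>; so the product can be written with
  lifts of transpositions of the smaller set \<open>A\<close>.
\<close>

lemma Ts_prod_eq_one: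
  assumes "A \<subseteq> S" "set ts \<subseteq> Ts A" "\<pi> (word_prod G ts) = id"
  shows "word_prod G ts = \<one>"
proof -
  have "finite A" using assms finite_S finite_subset by blast
  then show ?thesis using assms
  proof (induction A arbitrary: ts)
    case empty
    then show ?case by (simp add: Ts_def)
  next
    case (insert n A)
    obtain us where us: "set us \<subseteq> Ts A"
      "word_prod G ts = word_prod G us \<or> (\<exists>a\<in>A. word_prod G ts = T n a \<otimes> word_prod G us)"
      using Ts_prod_normal_form[of n A ts] insert by blast
    have "\<pi> (word_prod G ts) \<noteq> id" if a: "a \<in> A" "word_prod G ts = T n a \<otimes> word_prod G us" for a
    proof -
      have na: "n \<noteq> a" using a insert.hyps by auto
      have "word_prod G us \<in> carrier G"
        using us Ts_carrier[of A] insert.prems by (intro word_prod_closed) auto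
      then have "\<pi> (word_prod G ts) = transposition n a \<circ> \<pi> (word_prod G us)"
        using a na insert.prems by (simp add: \<pi>_mult T_closed \<pi>_T subset_iff)
      moreover have "\<pi> (word_prod G us) n = n"
        using \<pi>_Ts_prod_permutes[of A us] us insert by (simp add: permutes_not_in)
      ultimately have "\<pi> (word_prod G ts) n = a" by simp
      then show ?thesis using na by auto
    qed
    then have "word_prod G ts = word_prod G us" using us(2) insert.prems(3) by blast
    then show ?case using insert.IH[of us] us insert.prems by auto
  qed
qed

lemma Ts_prod_inverse:
  assumes "set ts \<subseteq> Ts S"
  shows "word_prod G ts \<otimes> word_prod G (rev ts) = \<one>"
  using assms
proof (induction ts)
  case (Cons t ts)
  have c: "t \<in> carrier G" "set ts \<subseteq> carrier G" "set (rev ts) \<subseteq> carrier G"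
    using Cons.prems Ts_carrier[of S] by auto
  have "t \<otimes> t = \<one>" using Cons.prems T_square by (auto simp: Ts_def)
  moreover have "word_prod G (t # ts) \<otimes> word_prod G (rev (t # ts)) =
      t \<otimes> (word_prod G ts \<otimes> word_prod G (rev ts)) \<otimes> t"
    using c by (simp add: word_prod_append word_prod_closed m_assoc)
  ultimately show ?case using Cons c by simp
qed simp

lemma Ts_prod_determined:
  assumes "set ts \<subseteq> Ts S" "set us \<subseteq> Ts S" "\<pi> (word_prod G ts) = \<pi> (word_prod G us)"
  shows "word_prod G ts = word_prod G us"
proof -
  have c: "set ts \<subseteq> carrier G" "set us \<subseteq> carrier G" "set (rev us) \<subseteq> carrier G"
    using assms Ts_carrier[of S] by auto
  note wc = word_prod_closed[OF c(1)] word_prod_closed[OF c(2)] word_prod_closed[OF c(3)]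
  have "\<pi> (word_prod G (ts @ rev us)) = \<pi> (word_prod G us \<otimes> word_prod G (rev us))"
    using assms c wc by (simp add: word_prod_append \<pi>_mult)
  also have "\<dots> = id" using Ts_prod_inverse[OF assms(2)] by simp
  finally have "word_prod G (ts @ rev us) = \<one>"
    using Ts_prod_eq_one[of S "ts @ rev us"] assms by simp
  then have "word_prod G ts \<otimes> word_prod G (rev us) = word_prod G us \<otimes> word_prod G (rev us)"
    using c Ts_prod_inverse[OF assms(2)] by (simp add: word_prod_append)
  then show ?thesis using wc by simp
qed

lemma Ts_prod_surj:
  assumes "h permutes S"
  shows "\<exists>ts. set ts \<subseteq> Ts S \<and> \<pi> (word_prod G ts) = h"
  using assms finite_S
proof (induction rule: permutes_induct)
  case id
  show ?case by (rule exI[of _ "[]"]) simp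
next
  case (swap a b h)
  then obtain ts where ts: "set ts \<subseteq> Ts S" "\<pi> (word_prod G ts) = h" by blast
  have "\<pi> (word_prod G (T a b # ts)) = transposition a b \<circ> h"
    using swap ts Ts_carrier[of S] by (simp add: \<pi>_mult \<pi>_T T_closed word_prod_closed)
  then show ?case using swap ts by (intro exI[of _ "T a b # ts"]) (auto intro: TsI)
qed

text \<open>
  By \<open>Ts_prod_determined\<close> the value of \<open>F h\<close> does not depend on how \<open>h\<close> is written as a product of
  transpositions, whence \<open>F\<close> is a homomorphism.
\<close>

theorem splitting:
  obtains F where "\<And>h. h permutes S \<Longrightarrow> F h \<in> carrier G" "\<And>h. h permutes S \<Longrightarrow> \<pi> (F h) = h"
    "\<And>g h. \<lbrakk>g permutes S; h permutes S\<rbrakk> \<Longrightarrow> F (g \<circ> h) = F g \<otimes> F h"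
proof -
  obtain W where W: "set (W h) \<subseteq> Ts S" "\<pi> (word_prod G (W h)) = h" if "h permutes S" for h
    using Ts_prod_surj by metis
  have c: "set (W h) \<subseteq> carrier G" if "h permutes S" for h
    using W(1)[OF that] Ts_carrier[of S] by auto
  show ?thesis
  proof (rule that[of "\<lambda>h. word_prod G (W h)"])
    fix g h assume gh: "g permutes S" "h permutes S"
    then have "g \<circ> h permutes S" by (simp add: permutes_compose)
    moreover have "\<pi> (word_prod G (W g @ W h)) = g \<circ> h"
      using gh W c by (simp add: word_prod_append \<pi>_mult word_prod_closed)
    ultimately have "word_prod G (W (g \<circ> h)) = word_prod G (W g @ W h)"
      using gh W by (intro Ts_prod_determined) auto
    then show "word_prod G (W (g \<circ> h)) = word_prod G (W g) \<otimes> word_prod G (W h)"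
      using gh c by (simp add: word_prod_append)
  qed (use W c word_prod_closed in auto)
qed

end


section \<open>Words in a split central extension\<close>

context group
begin

lemma word_prod_mset_cong:
  assumes "mset u = mset v" "set u \<subseteq> carrier G"
    and central: "\<And>a b. \<lbrakk>a \<in> set u; b \<in> carrier G\<rbrakk> \<Longrightarrow> a \<otimes> b = b \<otimes> a"
  shows "word_prod G u = word_prod G v"
  using assms
proof (induction u arbitrary: v)
  case (Cons a u)
  have sv: "set v = set (a # u)" using Cons.prems(1) by (metis set_mset_mset)
  then obtain v1 v2 where v: "v = v1 @ a # v2" using split_list[of a v] by auto
  then have c: "a \<in> carrier G" "set v1 \<subseteq> carrier G" "set v2 \<subseteq> carrier G"
    using Cons.prems(2) sv by auto
  note wc = word_prod_closed[OF c(2)] word_prod_closed[OF c(3)]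
  have IH: "word_prod G u = word_prod G (v1 @ v2)"
    using Cons.prems v by (intro Cons.IH) auto
  have "word_prod G v = word_prod G v1 \<otimes> a \<otimes> word_prod G v2"
    using v c wc by (simp add: word_prod_append m_assoc)
  also have "word_prod G v1 \<otimes> a = a \<otimes> word_prod G v1"
    using Cons.prems(3)[of a "word_prod G v1"] wc by simp
  finally show ?case using IH c wc by (simp add: word_prod_append m_assoc)
qed simp

lemma conj_class_eqD:
  assumes "conj_class G g = conj_class G g'" "g \<in> carrier G" "g' \<in> carrier G"
  obtains h where "h \<in> carrier G" "g' = h \<otimes> g \<otimes> inv h"
proof -
  have "g' \<in> conj_class G g'"
    unfolding conj_class_def using assms(3) by (auto intro!: exI[of _ \<one>])
  then show ?thesis using assms(1) that by (auto simp: conj_class_def)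
qed

end

text \<open>
  Write \<open>x g = F g \<otimes> \<kappa> g\<close>. The factor \<open>\<kappa> g\<close> lies in the kernel, hence is central, and it is
  unchanged when \<open>g\<close> is replaced by a conjugate because conjugation by \<open>F c\<close> fixes it. Collecting the
  central factors, a word in the \<open>x g\<close> equals \<open>F\<close> of its product times a product of values \<open>\<kappa> g\<close>
  that depends only on the conjugacy classes of the letters.
\<close>

theorem (in group_hom) word_prod_determined_by_type:
  assumes central: "\<And>z a. \<lbrakk>z \<in> carrier G; h z = \<one>\<^bsub>H\<^esub>; a \<in> carrier G\<rbrakk> \<Longrightarrow> z \<otimes> a = a \<otimes> z"
    and F: "F \<in> hom H G" "\<And>g. g \<in> carrier H \<Longrightarrow> h (F g) = g"
    and E: "E \<subseteq> carrier H"
    and x: "\<And>g. g \<in> E \<Longrightarrow> x g \<in> carrier G" "\<And>g. g \<in> E \<Longrightarrow> h (x g) = g"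
    and x_conj: "\<And>a g. \<lbrakk>a \<in> carrier G; g \<in> E\<rbrakk> \<Longrightarrow>
      a \<otimes> x g \<otimes> inv a = x (h a \<otimes>\<^bsub>H\<^esub> g \<otimes>\<^bsub>H\<^esub> inv\<^bsub>H\<^esub> h a)"
    and uv: "set u \<subseteq> E" "set v \<subseteq> E" "word_prod H u = word_prod H v"
      "mset (map (conj_class H) u) = mset (map (conj_class H) v)"
  shows "word_prod G (map x u) = word_prod G (map x v)"
proof -
  interpret F: group_hom H G F using F by unfold_locales
  define \<kappa> where "\<kappa> g = inv (F g) \<otimes> x g" for g
  have Ec: "g \<in> carrier H" if "g \<in> E" for g using that E by auto
  have \<kappa>c: "\<kappa> g \<in> carrier G" if "g \<in> E" for g using that x Ec by (simp add: \<kappa>_def)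
  have "h (\<kappa> g) = \<one>\<^bsub>H\<^esub>" if "g \<in> E" for g
    using that x Ec F by (simp add: \<kappa>_def)
  then have \<kappa>_central: "\<kappa> g \<otimes> a = a \<otimes> \<kappa> g" if "g \<in> E" "a \<in> carrier G" for g a
    using that \<kappa>c central by blast
  have \<kappa>_conj: "\<kappa> (c \<otimes>\<^bsub>H\<^esub> g \<otimes>\<^bsub>H\<^esub> inv\<^bsub>H\<^esub> c) = \<kappa> g" if "g \<in> E" "c \<in> carrier H" for c g
  proof -
    have g: "g \<in> carrier H" using that Ec by blast
    have "x (c \<otimes>\<^bsub>H\<^esub> g \<otimes>\<^bsub>H\<^esub> inv\<^bsub>H\<^esub> c) = F c \<otimes> x g \<otimes> inv (F c)"
      using x_conj[of "F c" g] that F by simp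
    moreover have "inv (F (c \<otimes>\<^bsub>H\<^esub> g \<otimes>\<^bsub>H\<^esub> inv\<^bsub>H\<^esub> c)) = F c \<otimes> inv (F g) \<otimes> inv (F c)"
      using that g by (simp add: G.inv_mult_group G.m_assoc)
    ultimately have "\<kappa> (c \<otimes>\<^bsub>H\<^esub> g \<otimes>\<^bsub>H\<^esub> inv\<^bsub>H\<^esub> c) = F c \<otimes> \<kappa> g \<otimes> inv (F c)"
      using that g x by (simp add: \<kappa>_def G.m_assoc)
    also have "\<dots> = \<kappa> g" using that \<kappa>_central[of g "F c"] \<kappa>c[of g] by (simp add: G.m_assoc flip: \<kappa>_central)
    finally show ?thesis .
  qed
  have prod_eq: "word_prod G (map x w) = F (word_prod H w) \<otimes> word_prod G (map \<kappa> w)"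
    if "set w \<subseteq> E" for w
    using that
  proof (induction w)
    case (Cons g w)
    then have g: "g \<in> E" "g \<in> carrier H" "set w \<subseteq> carrier H" "set (map \<kappa> w) \<subseteq> carrier G"
      using Ec \<kappa>c by auto
    note wc = H.word_prod_closed[OF g(3)] G.word_prod_closed[OF g(4)]
    have "x g = F g \<otimes> \<kappa> g" using g x by (simp add: \<kappa>_def)
    then have "word_prod G (map x (g # w)) =
        F g \<otimes> (\<kappa> g \<otimes> F (word_prod H w)) \<otimes> word_prod G (map \<kappa> w)"
      using Cons g wc \<kappa>c by (simp add: G.m_assoc)
    then show ?case
      using g wc \<kappa>c \<kappa>_central[of g "F (word_prod H w)"] by (simp add: G.m_assoc)
  qed simp
  define rep where "rep K = (SOME g. g \<in> E \<and> conj_class H g = K)" for K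
  have \<kappa>_rep: "\<kappa> g = \<kappa> (rep (conj_class H g))" if "g \<in> E" for g
  proof -
    have "rep (conj_class H g) \<in> E \<and> conj_class H (rep (conj_class H g)) = conj_class H g"
      unfolding rep_def by (rule someI[of _ g]) (use that in auto)
    then show ?thesis using that Ec \<kappa>_conj by (metis H.conj_class_eqD)
  qed
  have \<kappa>_map: "map \<kappa> w = map (\<kappa> \<circ> rep) (map (conj_class H) w)" if "set w \<subseteq> E" for w
    using that \<kappa>_rep by auto
  have "mset (map \<kappa> u) = mset (map \<kappa> v)"
    using uv(4) \<kappa>_map[OF uv(1)] \<kappa>_map[OF uv(2)] by (metis mset_map)
  then have "word_prod G (map \<kappa> u) = word_prod G (map \<kappa> v)"
    using uv \<kappa>c \<kappa>_central by (intro G.word_prod_mset_cong) auto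
  then show ?thesis using prod_eq uv by simp
qed


section \<open>Moving letters in the factorization semigroup\<close>

lemma fs_rel_mono: "\<lbrakk>(u, v) \<in> fs_rel G E'; E' \<subseteq> E\<rbrakk> \<Longrightarrow> (u, v) \<in> fs_rel G E"
  by (induction rule: fs_rel.induct) (auto intro: fs_rel.intros simp: fs_words_def)

context equipped_group
begin

definition fs_eq :: "'a list \<Rightarrow> 'a list \<Rightarrow> bool" (infix "\<sim>" 50) where
  "u \<sim> v \<longleftrightarrow> (u, v) \<in> fs_rel G E"

lemma fs_eq_refl: "w \<in> fs_words E \<Longrightarrow> w \<sim> w"
  and fs_eq_sym: "u \<sim> v \<Longrightarrow> v \<sim> u"
  and fs_eq_trans [trans]: "u \<sim> v \<Longrightarrow> v \<sim> w \<Longrightarrow> u \<sim> w"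
  and fs_eq_append: "u \<sim> u' \<Longrightarrow> v \<sim> v' \<Longrightarrow> u @ v \<sim> u' @ v'"
  unfolding fs_eq_def by (rule fs_rel.intros; assumption)+

lemma fs_eq_right_conj: "\<lbrakk>a \<in> E; b \<in> E\<rbrakk> \<Longrightarrow> [a, b] \<sim> [b, inv b \<otimes> a \<otimes> b]"
  and fs_eq_left_conj: "\<lbrakk>a \<in> E; b \<in> E\<rbrakk> \<Longrightarrow> [a, b] \<sim> [a \<otimes> b \<otimes> inv a, a]"
  and fs_eq_absorb_one: "\<lbrakk>a \<in> E; \<one> \<in> E\<rbrakk> \<Longrightarrow> [a, \<one>] \<sim> [a]"
  unfolding fs_eq_def by (rule fs_rel.intros; assumption)+

lemma fs_eq_words: "u \<sim> v \<Longrightarrow> u \<in> fs_words E \<and> v \<in> fs_words E"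
  unfolding fs_eq_def by (rule fs_rel_words)

lemma fs_eq_prod: "u \<sim> v \<Longrightarrow> word_prod G u = word_prod G v"
  unfolding fs_eq_def by (rule word_prod_cong)

lemma fs_eq_type: "u \<sim> v \<Longrightarrow> word_type G u = word_type G v"
  unfolding fs_eq_def by (rule word_type_cong)

lemma E_carrier: "g \<in> E \<Longrightarrow> g \<in> carrier G"
  using subset_carrier by auto

lemma fs_words_Cons [simp]: "a # w \<in> fs_words E \<longleftrightarrow> a \<in> E \<and> set w \<subseteq> E"
  by (auto simp: fs_words_def)

lemma fs_words_appendI:
  "\<lbrakk>u \<in> fs_words E; set v \<subseteq> E\<rbrakk> \<Longrightarrow> u @ v \<in> fs_words E"
  "\<lbrakk>u \<in> fs_words E; set v \<subseteq> E\<rbrakk> \<Longrightarrow> v @ u \<in> fs_words E"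
  by (auto simp: fs_words_def)

lemma fs_eq_append_left: "\<lbrakk>u \<sim> v; set w \<subseteq> E\<rbrakk> \<Longrightarrow> w @ u \<sim> w @ v"
  by (cases "w = []") (auto intro!: fs_eq_append fs_eq_refl simp: fs_words_def)

lemma fs_eq_append_right: "\<lbrakk>u \<sim> v; set w \<subseteq> E\<rbrakk> \<Longrightarrow> u @ w \<sim> v @ w"
  by (cases "w = []") (auto intro!: fs_eq_append fs_eq_refl simp: fs_words_def)

lemma fs_eq_Cons: "\<lbrakk>u \<sim> v; a \<in> E\<rbrakk> \<Longrightarrow> a # u \<sim> a # v"
  using fs_eq_append_left[of u v "[a]"] by simp

lemma move_letter_left:
  assumes "set u \<subseteq> E" "g \<in> E"
  shows "u @ [g] \<sim> (word_prod G u \<otimes> g \<otimes> inv (word_prod G u)) # u"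
  using assms(1)
proof (induction u)
  case Nil
  show ?case using assms E_carrier by (auto intro: fs_eq_refl)
next
  case (Cons a u)
  let ?p = "word_prod G u"
  have c: "a \<in> carrier G" "?p \<in> carrier G" "g \<in> carrier G"
    using Cons.prems assms E_carrier by (auto intro!: word_prod_closed)
  have g': "?p \<otimes> g \<otimes> inv ?p \<in> E" using c assms conj_closed by simp
  have "(a # u) @ [g] \<sim> [a, ?p \<otimes> g \<otimes> inv ?p] @ u"
    using Cons fs_eq_Cons by simp
  also have "\<dots> \<sim> [a \<otimes> (?p \<otimes> g \<otimes> inv ?p) \<otimes> inv a, a] @ u"
    using Cons.prems g' by (intro fs_eq_append_right fs_eq_left_conj) auto
  also have "a \<otimes> (?p \<otimes> g \<otimes> inv ?p) \<otimes> inv a =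
      word_prod G (a # u) \<otimes> g \<otimes> inv (word_prod G (a # u))"
    using c by (simp add: m_assoc inv_mult_group)
  finally show ?case by simp
qed

text \<open>
  A letter that is carried across a word is conjugated by the product of that word.
\<close>

lemma product_one_central:
  assumes "z \<in> fs_words E" "word_prod G z = \<one>" "set u \<subseteq> E"
  shows "z @ u \<sim> u @ z"
  using assms(3)
proof (induction u)
  case Nil
  show ?case using assms by (auto intro: fs_eq_refl)
next
  case (Cons a u)
  have z: "set z \<subseteq> E" using assms by (simp add: fs_words_def)
  have "z @ [a] \<sim> a # z"
    using move_letter_left[OF z, of a] Cons.prems assms E_carrier[of a] by simp
  then have "(z @ [a]) @ u \<sim> a # (z @ u)"
    using fs_eq_append_right[of "z @ [a]" "a # z" u] Cons.prems by simp
  also have "\<dots> \<sim> a # (u @ z)" using Cons by (intro fs_eq_Cons) auto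
  finally show ?case by simp
qed

text \<open>
  Carrying \<open>g\<close> to the front replaces each letter \<open>a\<close> that it passes by \<open>g\<inverse> a g\<close>. Conjugation by \<open>g\<close>
  neither destroys nor creates a letter \<open>g\<close>, so the remaining occurrences of \<open>g\<close> can be pulled out
  in turn.
\<close>

lemma pull_letter_front:
  assumes "w \<in> fs_words E" "g \<in> set w"
  shows "\<exists>w'. w \<sim> g # w' \<and> count_list w' g = count_list w g - 1"
  using assms
proof (induction w)
  case (Cons a w)
  show ?case
  proof (cases "a = g")
    case True
    then show ?thesis using Cons.prems by (intro exI[of _ w]) (auto intro: fs_eq_refl)
  next
    case False
    then have "w \<in> fs_words E" "g \<in> set w" "a \<in> E" "g \<in> E"
      using Cons.prems by (auto simp: fs_words_def)
    then obtain w' where w': "w \<sim> g # w'" "count_list w' g = count_list w g - 1"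
      using Cons.IH by auto
    have "set w' \<subseteq> E" using fs_eq_words[OF w'(1)] by simp
    have c: "a \<in> carrier G" "g \<in> carrier G" using \<open>a \<in> E\<close> \<open>g \<in> E\<close> E_carrier by auto
    have ne: "inv g \<otimes> a \<otimes> g \<noteq> g"
    proof
      assume "inv g \<otimes> a \<otimes> g = g"
      then have "g \<otimes> (inv g \<otimes> a \<otimes> g) = g \<otimes> g" by simp
      then show False using c False by (simp add: m_assoc)
    qed
    have "a # w \<sim> [a, g] @ w'" using w' \<open>a \<in> E\<close> fs_eq_Cons by simp
    also have "\<dots> \<sim> [g, inv g \<otimes> a \<otimes> g] @ w'"
      using \<open>a \<in> E\<close> \<open>g \<in> E\<close> \<open>set w' \<subseteq> E\<close> by (intro fs_eq_append_right fs_eq_right_conj)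
    finally show ?thesis
      using w' ne False by (intro exI[of _ "(inv g \<otimes> a \<otimes> g) # w'"]) auto
  qed
qed simp

lemma pull_power_front:
  assumes "w \<in> fs_words E" "k \<le> count_list w g"
  shows "\<exists>w'. w \<sim> replicate k g @ w'"
  using assms
proof (induction k arbitrary: w)
  case 0
  then show ?case by (auto intro: fs_eq_refl)
next
  case (Suc k)
  then have "g \<in> set w" by (metis count_list_0_iff not_less_eq_eq le0)
  then obtain w1 where w1: "w \<sim> g # w1" "count_list w1 g = count_list w g - 1"
    using pull_letter_front Suc.prems by blast
  then have "g \<in> E" "set w1 \<subseteq> E" using fs_eq_words by fastforce+
  show ?case
  proof (cases "w1 = []")
    case True
    then have "k = 0" using w1 Suc.prems by auto
    then show ?thesis using w1 by auto
  next
    case False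
    moreover have "k \<le> count_list w1 g" using w1(2) Suc.prems by linarith
    ultimately obtain w' where "w1 \<sim> replicate k g @ w'"
      using Suc.IH[of w1] \<open>set w1 \<subseteq> E\<close> by (auto simp: fs_words_def)
    then have "w \<sim> g # replicate k g @ w'"
      using w1(1) \<open>g \<in> E\<close> fs_eq_Cons fs_eq_trans by blast
    then show ?thesis by auto
  qed
qed

text \<open>
  The relation \<open>x\<^sub>a x\<^sub>\<one> = x\<^sub>a\<close> needs a letter to absorb the unit; a unit in front is absorbed by the
  next letter after commuting with it, which is why some nonempty \<open>w\<close> has to follow.
\<close>

lemma remove_ones:
  assumes "set u \<subseteq> E" "w \<in> fs_words E"
  shows "u @ w \<sim> filter (\<lambda>g. g \<noteq> \<one>) u @ w"
  using assms(1)
proof (induction u)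
  case Nil
  show ?case using assms by (auto intro: fs_eq_refl)
next
  case (Cons a u)
  show ?case
  proof (cases "a = \<one>")
    case True
    have "filter (\<lambda>g. g \<noteq> \<one>) u @ w \<in> fs_words E"
      using assms Cons.prems by (intro fs_words_appendI) auto
    then obtain b v where bv: "filter (\<lambda>g. g \<noteq> \<one>) u @ w = b # v" "b \<in> E" "set v \<subseteq> E"
      by (cases "filter (\<lambda>g. g \<noteq> \<one>) u @ w") (auto simp: fs_words_def)
    have one: "\<one> \<in> E" using Cons.prems True by simp
    have "[\<one>, b] \<sim> [b, \<one>]"
      using fs_eq_right_conj[OF one bv(2)] E_carrier[OF bv(2)] by simp
    also have "\<dots> \<sim> [b]" using bv one by (intro fs_eq_absorb_one)
    finally have "[\<one>, b] @ v \<sim> [b] @ v" using bv by (intro fs_eq_append_right)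
    then have absorb: "a # (filter (\<lambda>g. g \<noteq> \<one>) u @ w) \<sim> filter (\<lambda>g. g \<noteq> \<one>) u @ w"
      using True bv by simp
    have "(a # u) @ w \<sim> a # (filter (\<lambda>g. g \<noteq> \<one>) u @ w)"
      using Cons fs_eq_Cons by simp
    also note absorb
    finally show ?thesis using True by simp
  next
    case False
    then show ?thesis using Cons fs_eq_Cons by simp
  qed
qed

end

context group
begin

lemma word_prod_replicate: "g \<in> carrier G \<Longrightarrow> word_prod G (replicate k g) = g [^] k"
  by (induction k) (simp_all del: nat_pow_Suc flip: nat_pow_Suc2)

lemma word_prod_replicate_order:
  "g \<in> carrier G \<Longrightarrow> word_prod G (replicate (order G) g) = \<one>"
  by (simp add: word_prod_replicate pow_order_eq_1)

end

context equipped_group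
begin

text \<open>
  Appending the powers \<open>g\<^sup>N\<close> with \<open>N\<close> the order of the group, for all letters \<open>g\<close>, leaves the
  product unchanged.
\<close>

lemma exists_word_containing_letters:
  assumes "finite (carrier G)" "u \<in> fs_words E"
  obtains w where "w \<in> fs_words E" "word_prod G w = word_prod G u" "E \<subseteq> set w"
proof -
  have "finite E" using assms subset_carrier finite_subset by blast
  then obtain ls where ls: "set ls = E" using finite_list by blast
  define big where "big l = concat (map (replicate (order G)) l)" for l :: "'a list"
  have "0 < order G" using assms(1) by (simp add: order_gt_0_iff_finite)
  then have set_big: "set (big l) = set l" for l by (auto simp: big_def)
  have "word_prod G (big l) = \<one>" if "set l \<subseteq> E" for l
    using that
  proof (induction l)
    case (Cons g l)
    have "big (g # l) = replicate (order G) g @ big l" by (simp add: big_def)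
    moreover have "set (replicate (order G) g) \<subseteq> carrier G" "set (big l) \<subseteq> carrier G"
      using Cons.prems subset_carrier set_big[of l] by auto
    ultimately show ?case
      using Cons word_prod_replicate_order[of g] subset_carrier by (auto simp: word_prod_append)
  qed (simp add: big_def)
  then have "word_prod G (u @ big ls) = word_prod G u"
    using assms fs_words_carrier[of u] set_big[of ls] ls subset_carrier
    by (simp add: word_prod_append word_prod_closed)
  moreover have "u @ big ls \<in> fs_words E" using assms ls set_big by (intro fs_words_appendI) auto
  moreover have "E \<subseteq> set (u @ big ls)" using ls set_big by auto
  ultimately show ?thesis using that by blast
qed

lemma word_prod_map_conj:
  assumes "h \<in> carrier G" "set w \<subseteq> carrier G"
  shows "word_prod G (map (\<lambda>g. h \<otimes> g \<otimes> inv h) w) = h \<otimes> word_prod G w \<otimes> inv h"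
  using assms(2)
proof (induction w)
  case (Cons g w)
  then have "word_prod G w \<in> carrier G" by (intro word_prod_closed) auto
  then show ?case using Cons assms(1) by (simp add: m_assoc)
qed (use assms in simp)

text \<open>
  In a finite group inverses are positive powers, so words without inverse letters already give a
  subgroup.
\<close>

lemma word_products_normal:
  assumes fin: "finite (carrier G)" and ne: "E \<noteq> {}"
  shows "normal (word_prod G ` fs_words E) G"
proof -
  let ?H = "word_prod G ` fs_words E"
  have sub: "?H \<subseteq> carrier G" using fs_words_carrier word_prod_closed by blast
  have mult: "a \<otimes> b \<in> ?H" if "a \<in> ?H" "b \<in> ?H" for a b
  proof -
    obtain u v where uv: "u \<in> fs_words E" "v \<in> fs_words E" "a = word_prod G u" "b = word_prod G v"
      using \<open>a \<in> ?H\<close> \<open>b \<in> ?H\<close> by blast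
    then have "a \<otimes> b = word_prod G (u @ v)"
      using fs_words_carrier by (simp add: word_prod_append)
    then show ?thesis using uv fs_words_append by blast
  qed
  have pow: "a [^] Suc k \<in> ?H" if "a \<in> ?H" for a and k :: nat
    using that sub mult by (induction k) auto
  have pos: "0 < order G" using fin by (simp add: order_gt_0_iff_finite)
  show ?thesis
  proof (rule normal_invI)
    show "subgroup ?H G"
    proof (rule subgroupI)
      from ne obtain g where "g \<in> E" by blast
      then have "[g] \<in> fs_words E" by simp
      then show "?H \<noteq> {}" by blast
      fix a assume a: "a \<in> ?H"
      then have aG: "a \<in> carrier G" using sub by blast
      \<comment> \<open>\<open>a\<inverse> = a\<^bsup>2 N - 1\<^esup>\<close> for \<open>N\<close> the order; the exponent \<open>2 N - 1\<close> is positive even for \<open>N = 1\<close>,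
        and a positive one is needed because the empty word is excluded.\<close>
      define k where "k = 2 * order G - 2"
      have "Suc (Suc k) = order G + order G" using pos by (simp add: k_def)
      then have "a [^] Suc k \<otimes> a = a [^] (order G + order G)" by (metis nat_pow_Suc)
      also have "\<dots> = \<one>" using aG pow_order_eq_1[OF aG] nat_pow_mult[OF aG] by (metis l_one one_closed)
      finally have "inv a = a [^] Suc k" using aG by (intro inv_equality) auto
      then show "inv a \<in> ?H" using pow[OF a] by metis
    qed (use sub mult in auto)
    fix h a assume h: "h \<in> carrier G" and "a \<in> ?H"
    then obtain u where u: "u \<in> fs_words E" "a = word_prod G u" by blast
    have "map (\<lambda>g. h \<otimes> g \<otimes> inv h) u \<in> fs_words E"
      using u h conj_closed by (auto simp: fs_words_def)
    moreover have "h \<otimes> a \<otimes> inv h = word_prod G (map (\<lambda>g. h \<otimes> g \<otimes> inv h) u)"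
      using u h fs_words_carrier by (simp add: word_prod_map_conj)
    ultimately show "h \<otimes> a \<otimes> inv h \<in> ?H" by blast
  qed
qed

lemma word_type_eq_mset:
  "set w \<subseteq> E - {\<one>} \<Longrightarrow> word_type G w = mset (map (conj_class G) w)"
  by (induction w) (auto simp: word_type_def)

end


section \<open>The group of stable classes\<close>

text \<open>
  The word \<open>s\<close> is central by \<open>s_prod\<close> and a multiple of every letter by \<open>letter_divides_s\<close>, so
  making it trivial inverts every letter.
\<close>

locale stabilizing_word = equipped_group +
  fixes s :: "'a list"
  assumes s_word: "s \<in> fs_words E" and s_prod: "word_prod G s = \<one>"
    and letter_divides_s: "g \<in> E \<Longrightarrow> g \<in> set s"
    and generated: "a \<in> carrier G \<Longrightarrow> \<exists>u\<in>fs_words E. word_prod G u = a"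
begin

definition s_pow :: "nat \<Rightarrow> 'a list" where "s_pow i = concat (replicate i s)"

lemma s_pow_simps: "s_pow 0 = []" "s_pow (Suc i) = s @ s_pow i" "s_pow 1 = s"
  by (simp_all add: s_pow_def)

lemma s_pow_add: "s_pow (i + j) = s_pow i @ s_pow j"
  by (simp add: s_pow_def replicate_add)

lemma set_s: "set s \<subseteq> E" using s_word by (simp add: fs_words_def)

lemma set_s_pow: "set (s_pow i) \<subseteq> E"
  using set_s by (auto simp: s_pow_def)

lemma prod_s_pow: "word_prod G (s_pow i) = \<one>"
proof (induction i)
  case (Suc i)
  have "set s \<subseteq> carrier G" "set (s_pow i) \<subseteq> carrier G"
    using set_s set_s_pow[of i] subset_carrier by auto
  then show ?case using Suc s_prod by (simp add: s_pow_simps word_prod_append)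
qed (simp add: s_pow_simps)

lemma s_pow_central:
  assumes "u \<in> fs_words E"
  shows "s_pow i @ u \<sim> u @ s_pow i"
proof (cases "s_pow i = []")
  case False
  then have "s_pow i \<in> fs_words E" using set_s_pow by (simp add: fs_words_def)
  then show ?thesis using product_one_central prod_s_pow assms by (simp add: fs_words_def)
qed (use assms in \<open>auto intro: fs_eq_refl\<close>)

text \<open>
  Identifying \<open>s\<close> with the unit, instead of adjoining an inverse of it, keeps all elements of the
  resulting group represented by words; different exponents are allowed for that reason. For words
  of equal type the exponents agree as soon as \<open>s\<close> contains a letter other than \<open>\<one>\<close>.
\<close>

definition stable_rel :: "('a list \<times> 'a list) set" where
  "stable_rel = {(u, v). u \<in> fs_words E \<and> v \<in> fs_words E \<and> (\<exists>i j. u @ s_pow i \<sim> v @ s_pow j)}"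

lemma fs_eq_imp_stable_rel: "u \<sim> v \<Longrightarrow> (u, v) \<in> stable_rel"
proof -
  assume uv: "u \<sim> v"
  then have "u @ s_pow 0 \<sim> v @ s_pow 0" by (simp add: s_pow_simps)
  then show ?thesis using fs_eq_words[OF uv] unfolding stable_rel_def by blast
qed

lemma equiv_stable_rel: "equiv (fs_words E) stable_rel"
proof (rule equivI)
  show "stable_rel \<subseteq> fs_words E \<times> fs_words E" by (auto simp: stable_rel_def)
  show "refl_on (fs_words E) stable_rel"
    by (auto intro!: refl_onI fs_eq_imp_stable_rel fs_eq_refl)
  show "sym stable_rel" by (rule symI) (auto simp: stable_rel_def intro: fs_eq_sym)
  show "trans stable_rel"
  proof (rule transI)
    fix u v w assume "(u, v) \<in> stable_rel" "(v, w) \<in> stable_rel"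
    then obtain i j k l where uvw: "u \<in> fs_words E" "w \<in> fs_words E"
      and 1: "u @ s_pow i \<sim> v @ s_pow j" and 2: "v @ s_pow k \<sim> w @ s_pow l"
      by (auto simp: stable_rel_def)
    have "u @ s_pow (i + k) \<sim> v @ s_pow (j + k)"
      using fs_eq_append_right[OF 1 set_s_pow[of k]] by (simp add: s_pow_add)
    also have "v @ s_pow (j + k) = (v @ s_pow k) @ s_pow j"
      by (simp flip: s_pow_add add: add.commute)
    also have "\<dots> \<sim> (w @ s_pow l) @ s_pow j" by (rule fs_eq_append_right[OF 2 set_s_pow])
    finally have "u @ s_pow (i + k) \<sim> w @ s_pow (l + j)" by (simp add: s_pow_add)
    then show "(u, w) \<in> stable_rel" using uvw by (auto simp: stable_rel_def)
  qed
qed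

lemma stable_rel_append:
  assumes "(u, u') \<in> stable_rel" "(v, v') \<in> stable_rel"
  shows "(u @ v, u' @ v') \<in> stable_rel"
proof -
  obtain i j k l where W: "u \<in> fs_words E" "u' \<in> fs_words E" "v \<in> fs_words E" "v' \<in> fs_words E"
    and 1: "u @ s_pow i \<sim> u' @ s_pow j" and 2: "v @ s_pow k \<sim> v' @ s_pow l"
    using assms by (auto simp: stable_rel_def)
  have swap: "(a @ b) @ s_pow (m + n) \<sim> (a @ s_pow m) @ (b @ s_pow n)"
    if "a \<in> fs_words E" "b \<in> fs_words E" for a b m n
  proof -
    have "a @ (b @ s_pow m) @ s_pow n \<sim> a @ (s_pow m @ b) @ s_pow n"
      using that set_s_pow[of n]
      by (intro fs_eq_append_left fs_eq_append_right fs_eq_sym[OF s_pow_central])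
        (auto simp: fs_words_def)
    then show ?thesis by (simp add: s_pow_add)
  qed
  have "(u @ v) @ s_pow (i + k) \<sim> (u @ s_pow i) @ (v @ s_pow k)" using W by (intro swap)
  also have "\<dots> \<sim> (u' @ s_pow j) @ (v' @ s_pow l)" using 1 2 by (rule fs_eq_append)
  also have "\<dots> \<sim> (u' @ v') @ s_pow (j + l)" using W by (intro fs_eq_sym[OF swap])
  finally show ?thesis using W by (auto simp: stable_rel_def fs_words_append)
qed

lemma stable_rel_prod: "(u, v) \<in> stable_rel \<Longrightarrow> word_prod G u = word_prod G v"
proof -
  assume "(u, v) \<in> stable_rel"
  then obtain i j where "u \<in> fs_words E" "v \<in> fs_words E" "u @ s_pow i \<sim> v @ s_pow j"
    by (auto simp: stable_rel_def)
  moreover have "word_prod G (w @ s_pow i) = word_prod G w" if "w \<in> fs_words E" for w i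
  proof -
    have "set w \<subseteq> carrier G" "set (s_pow i) \<subseteq> carrier G"
      using that fs_words_carrier set_s_pow[of i] subset_carrier by auto
    then show ?thesis by (simp add: word_prod_append prod_s_pow word_prod_closed)
  qed
  ultimately show ?thesis using fs_eq_prod by metis
qed

definition cls :: "'a list \<Rightarrow> 'a list set" where "cls u = stable_rel `` {u}"

definition stable_group :: "'a list set monoid" where
  "stable_group = \<lparr>carrier = fs_words E // stable_rel,
    mult = (\<lambda>A B. \<Union>u\<in>A. \<Union>v\<in>B. cls (u @ v)), one = cls s\<rparr>"

lemma cls_in_carrier [simp]: "u \<in> fs_words E \<Longrightarrow> cls u \<in> carrier stable_group"
  by (simp add: stable_group_def cls_def quotientI)

lemma carrierE:
  assumes "A \<in> carrier stable_group"
  obtains u where "u \<in> fs_words E" "A = cls u"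
  using assms by (auto simp: stable_group_def cls_def elim: quotientE)

lemma one_stable_group: "\<one>\<^bsub>stable_group\<^esub> = cls s"
  by (simp add: stable_group_def)

lemma cls_eq_iff:
  "\<lbrakk>u \<in> fs_words E; v \<in> fs_words E\<rbrakk> \<Longrightarrow> cls u = cls v \<longleftrightarrow> (u, v) \<in> stable_rel"
  unfolding cls_def by (rule eq_equiv_class_iff[OF equiv_stable_rel])

lemma cls_eqI: "u \<sim> v \<Longrightarrow> cls u = cls v"
  using cls_eq_iff fs_eq_imp_stable_rel fs_eq_words by blast

lemma mult_cls:
  assumes "u \<in> fs_words E" "v \<in> fs_words E"
  shows "cls u \<otimes>\<^bsub>stable_group\<^esub> cls v = cls (u @ v)"
proof -
  have "congruent2 stable_rel stable_rel (\<lambda>u v. cls (u @ v))"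
    unfolding cls_def
    by (intro congruent2I' equiv_class_eq[OF equiv_stable_rel] stable_rel_append)
  from UN_equiv_class2[OF equiv_stable_rel equiv_stable_rel this assms] show ?thesis
    by (simp add: stable_group_def cls_def)
qed

lemma cls_s_append:
  assumes "u \<in> fs_words E"
  shows "cls (s @ u) = cls u"
proof -
  have "(s @ u) @ s_pow 0 \<sim> u @ s_pow 1"
    using s_pow_central[OF assms, of 1] by (simp add: s_pow_simps)
  then have "(s @ u, u) \<in> stable_rel"
    unfolding stable_rel_def using assms s_word fs_words_append by blast
  then show ?thesis using cls_eq_iff assms s_word fs_words_append by blast
qed

text \<open>
  Letter by letter: if \<open>s = r g\<close> then \<open>r\<close> is a left inverse of \<open>g\<close>. Pulling \<open>g\<close> out of \<open>s\<close> yields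
  \<open>s = g r\<close>, and \<open>g\<close> and \<open>r\<close> commute because \<open>r\<close> has product \<open>g\<inverse>\<close>.
\<close>

lemma left_inverse_word:
  assumes "u \<in> fs_words E"
  shows "\<exists>v\<in>fs_words E. cls (v @ u) = cls s"
proof -
  have "set u \<subseteq> E" using assms by (simp add: fs_words_def)
  then show ?thesis
  proof (induction u)
    case Nil
    then show ?case using s_word by auto
  next
    case (Cons g u)
    then obtain v where v: "v \<in> fs_words E" "cls (v @ u) = cls s" by auto
    obtain r where r: "s \<sim> g # r" using pull_letter_front[OF s_word letter_divides_s[of g]] Cons.prems by auto
    then have "set r \<subseteq> E" using fs_eq_words[of s "g # r"] by simp
    have grs: "word_prod G (g # r) = \<one>" using fs_eq_prod[OF r] s_prod by simp
    have gE: "g \<in> E" using Cons by simp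
    have "g # r \<sim> r @ [g]"
    proof -
      let ?p = "word_prod G r"
      have c: "?p \<in> carrier G" "g \<in> carrier G"
        using \<open>set r \<subseteq> E\<close> gE E_carrier by (auto intro!: word_prod_closed)
      then have "inv ?p = g" using grs by (intro inv_equality) auto
      then have "?p \<otimes> g \<otimes> inv ?p = g" using c by (metis r_inv l_one)
      then show ?thesis
        using move_letter_left[OF \<open>set r \<subseteq> E\<close> gE] fs_eq_sym by metis
    qed
    then have "s \<sim> r @ [g]" using r fs_eq_trans by blast
    then have "v @ (r @ [g]) @ u \<sim> v @ s @ u"
      using v Cons.prems
      by (intro fs_eq_append_left fs_eq_append_right) (auto intro: fs_eq_sym simp: fs_words_def)
    then have "cls ((v @ r) @ (g # u)) = cls (v @ s @ u)" using cls_eqI by simp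
    also have "\<dots> = cls (s @ v @ u)"
    proof (rule cls_eqI)
      show "v @ s @ u \<sim> s @ v @ u"
        using fs_eq_append_right[OF fs_eq_sym[OF s_pow_central[OF v(1), of 1]], of u] Cons.prems
        by (simp add: s_pow_simps)
    qed
    also have "\<dots> = cls s" using v cls_s_append fs_words_appendI Cons.prems by simp
    finally show ?case using v \<open>set r \<subseteq> E\<close> fs_words_appendI by blast
  qed
qed

lemma group_stable_group: "group stable_group"
proof (rule groupI)
  fix A B C
  assume A: "A \<in> carrier stable_group"
  show "\<one>\<^bsub>stable_group\<^esub> \<otimes>\<^bsub>stable_group\<^esub> A = A"
    using A s_word by (auto elim!: carrierE simp: one_stable_group mult_cls cls_s_append)
  show "\<exists>B\<in>carrier stable_group. B \<otimes>\<^bsub>stable_group\<^esub> A = \<one>\<^bsub>stable_group\<^esub>"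
  proof -
    obtain u where u: "u \<in> fs_words E" "A = cls u" using A carrierE by blast
    obtain v where v: "v \<in> fs_words E" "cls (v @ u) = cls s" using u left_inverse_word by blast
    have "cls v \<otimes>\<^bsub>stable_group\<^esub> A = \<one>\<^bsub>stable_group\<^esub>"
      using u v by (simp add: one_stable_group mult_cls)
    then show ?thesis using v(1) cls_in_carrier by blast
  qed
  assume B: "B \<in> carrier stable_group"
  then show "A \<otimes>\<^bsub>stable_group\<^esub> B \<in> carrier stable_group"
    using A by (auto elim!: carrierE simp: mult_cls fs_words_append)
  assume "C \<in> carrier stable_group"
  then show "A \<otimes>\<^bsub>stable_group\<^esub> B \<otimes>\<^bsub>stable_group\<^esub> C = A \<otimes>\<^bsub>stable_group\<^esub> (B \<otimes>\<^bsub>stable_group\<^esub> C)"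
    using A B by (auto elim!: carrierE simp: mult_cls fs_words_append)
qed (use s_word in \<open>simp add: one_stable_group\<close>)

sublocale \<Gamma>: group stable_group by (rule group_stable_group)

lemma fs_alpha_cls:
  assumes "u \<in> fs_words E"
  shows "fs_alpha G (cls u) = word_prod G u"
proof -
  have "u \<in> cls u" using assms equiv_class_self[OF equiv_stable_rel] by (simp add: cls_def)
  moreover have "word_prod G v = word_prod G u" if "v \<in> cls u" for v
    using that stable_rel_prod[of u v] by (simp add: cls_def)
  ultimately have "word_prod G ` cls u = {word_prod G u}" by blast
  then show ?thesis by (simp add: fs_alpha_def)
qed

lemma fs_alpha_hom: "fs_alpha G \<in> hom stable_group G"
proof (rule homI)
  fix A assume "A \<in> carrier stable_group"
  then obtain u where u: "u \<in> fs_words E" "A = cls u" by (rule carrierE)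
  then show "fs_alpha G A \<in> carrier G"
    using word_prod_closed[OF fs_words_carrier] by (simp add: fs_alpha_cls)
  fix B assume "B \<in> carrier stable_group"
  then obtain v where v: "v \<in> fs_words E" "B = cls v" by (rule carrierE)
  show "fs_alpha G (A \<otimes>\<^bsub>stable_group\<^esub> B) = fs_alpha G A \<otimes> fs_alpha G B"
    using u v word_prod_append[OF fs_words_carrier fs_words_carrier]
    by (simp add: mult_cls fs_alpha_cls fs_words_append)
qed

sublocale \<alpha>: group_hom stable_group G "fs_alpha G"
  by unfold_locales (rule fs_alpha_hom)

lemma fs_alpha_surj: "a \<in> carrier G \<Longrightarrow> \<exists>A\<in>carrier stable_group. fs_alpha G A = a"
  using generated[of a] fs_alpha_cls cls_in_carrier by metis

lemma kernel_central:
  assumes "A \<in> carrier stable_group" "fs_alpha G A = \<one>" "B \<in> carrier stable_group"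
  shows "A \<otimes>\<^bsub>stable_group\<^esub> B = B \<otimes>\<^bsub>stable_group\<^esub> A"
proof -
  obtain u v where uv: "u \<in> fs_words E" "A = cls u" "v \<in> fs_words E" "B = cls v"
    using assms carrierE by metis
  then have "u @ v \<sim> v @ u"
    using assms fs_alpha_cls by (intro product_one_central) (auto simp: fs_words_def)
  then show ?thesis using uv cls_eqI by (simp add: mult_cls)
qed

lemma conj_letter:
  assumes "A \<in> carrier stable_group" "g \<in> E"
  shows "A \<otimes>\<^bsub>stable_group\<^esub> cls [g] \<otimes>\<^bsub>stable_group\<^esub> inv\<^bsub>stable_group\<^esub> A =
    cls [fs_alpha G A \<otimes> g \<otimes> inv (fs_alpha G A)]"
proof -
  obtain u where u: "u \<in> fs_words E" "A = cls u" using assms carrierE by metis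
  let ?g = "word_prod G u \<otimes> g \<otimes> inv (word_prod G u)"
  have "?g \<in> E" using assms u fs_words_carrier word_prod_closed conj_closed by blast
  moreover have "u @ [g] \<sim> [?g] @ u"
    using move_letter_left[of u g] u assms by (simp add: fs_words_def)
  ultimately have "A \<otimes>\<^bsub>stable_group\<^esub> cls [g] = cls [?g] \<otimes>\<^bsub>stable_group\<^esub> A"
    using u assms cls_eqI by (simp add: mult_cls)
  then show ?thesis using assms u \<open>?g \<in> E\<close> by (simp add: fs_alpha_cls \<Gamma>.m_assoc)
qed

lemma word_prod_cls:
  assumes "u \<in> fs_words E"
  shows "word_prod stable_group (map (\<lambda>g. cls [g]) u) = cls u"
proof -
  have "set u \<subseteq> E" "u \<noteq> []" using assms by (auto simp: fs_words_def)
  from this(2,1) show ?thesis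
  proof (induction u rule: list_nonempty_induct)
    case (single g)
    then show ?case by simp
  next
    case (cons g u)
    then show ?case by (simp add: mult_cls fs_words_def)
  qed
qed

end


section \<open>One stabilizing element for all words\<close>


lemma pigeonhole_count_list:
  assumes "set w \<subseteq> A" "finite A" "A \<noteq> {}" "card A * k \<le> length w"
  shows "\<exists>a\<in>A. k \<le> count_list w a"
proof (rule ccontr)
  assume "\<not> ?thesis"
  then have "\<And>a. a \<in> A \<Longrightarrow> count_list w a < k" by (metis leI)
  then have "sum (count_list w) A < card A * k"
    using sum_bounded_above_strict[of A "count_list w" k] assms by (simp add: card_gt_0_iff)
  then show False using assms sum_count_set[of w A] by simp
qed

lemma finite_uniform_bound:
  fixes Q :: "'x \<Rightarrow> nat \<Rightarrow> bool"
  assumes "finite A" "\<And>a. a \<in> A \<Longrightarrow> \<exists>i. Q a i" "\<And>a i j. \<lbrakk>Q a i; i \<le> j\<rbrakk> \<Longrightarrow> Q a j"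
  shows "\<exists>i. \<forall>a\<in>A. Q a i"
proof -
  obtain f where f: "Q a (f a)" if "a \<in> A" for a using assms(2) by metis
  have "Q a (Max (f ` A))" if "a \<in> A" for a
    using f[OF that] by (rule assms(3)) (use that assms(1) in auto)
  then show ?thesis by blast
qed

lemma count_mset_map: "count (mset (map f w)) K = length (filter (\<lambda>x. f x = K) w)"
  by (induction w) auto

lemma count_list_le_length_filter: "P a \<Longrightarrow> count_list w a \<le> length (filter P w)"
  by (induction w) auto

lemma count_list_filter_le: "count_list (filter P w) a \<le> count_list w a"
  by (induction w) auto

context stabilizing_word
begin

lemma size_type_s_pow: "size (word_type G (s_pow i)) = i * size (word_type G s)"
  by (induction i) (simp_all add: s_pow_simps word_type_append, simp add: word_type_def)

lemma eq_after_power_mono: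
  assumes "u @ s_pow i \<sim> v @ s_pow i" "i \<le> j"
  shows "u @ s_pow j \<sim> v @ s_pow j"
proof -
  have "s_pow j = s_pow i @ s_pow (j - i)" using assms(2) by (simp flip: s_pow_add)
  then show ?thesis using fs_eq_append_right[OF assms(1) set_s_pow[of "j - i"]] by simp
qed

text \<open>
  Equal classes in the stable group mean equality after multiplying by powers \<open>s\<^sup>i\<close> and \<open>s\<^sup>j\<close>;
  comparing types shows \<open>i = j\<close>, since \<open>s\<close> contains a letter other than \<open>\<one>\<close>. The exponent depends on
  the two words. It can be chosen uniformly for the finitely many words of length at most \<open>L\<close>, and
  longer words reduce to these: by the pigeonhole principle a long word contains some letter \<open>g\<close>
  very often, so every word of the same type contains some conjugate \<open>h\<close> of \<open>g\<close> at least \<open>N\<close>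
  times, where \<open>N\<close> is the order of the group; both powers \<open>g\<^sup>N\<close>, \<open>h\<^sup>N\<close> have product \<open>\<one>\<close> and the same
  type, and can be split off.
\<close>

lemma stable_if_group_determined:
  assumes fin: "finite (carrier G)" and g0: "g0 \<in> E" "g0 \<noteq> \<one>"
    and det: "\<And>u v. \<lbrakk>u \<in> fs_words E; v \<in> fs_words E; word_prod G u = word_prod G v;
      mset (map (conj_class G) u) = mset (map (conj_class G) v)\<rbrakk> \<Longrightarrow> cls u = cls v"
  shows "stable_fact_semigroup G E"
proof -
  define E0 where "E0 = E - {\<one>}"
  \<comment> \<open>Without the letter \<open>\<one>\<close> the type counts every letter, so it determines the length.\<close>
  interpret E0: equipped_group G E0
    using subset_carrier conj_closed conj_eq_one_iff by unfold_locales (auto simp: E0_def subset_iff)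
  have finE: "finite E" using fin subset_carrier finite_subset by blast
  have E0: "E0 \<subseteq> E" "E0 \<noteq> {}" "finite E0" using g0 finE by (auto simp: E0_def)
  have pos: "0 < size (word_type G s)"
    using letter_divides_s[OF g0(1)] g0(2)
    by (auto simp: word_type_def nonempty_has_size[symmetric] filter_mset_eq_conv)
  define same where "same u v \<longleftrightarrow> set u \<subseteq> E0 \<and> set v \<subseteq> E0 \<and>
    word_prod G u = word_prod G v \<and> word_type G u = word_type G v" for u v
  have type: "word_type G u = mset (map (conj_class G) u)" if "set u \<subseteq> E0" for u
    using that word_type_eq_mset by (simp add: E0_def)
  have len: "length u = length v" if "same u v" for u v
    using that type unfolding same_def by (metis length_map size_mset)
  have E0G: "set u \<subseteq> carrier G" "set u \<subseteq> E" if "set u \<subseteq> E0" for u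
    using that E0(1) subset_carrier by auto
  have sG: "set s \<subseteq> carrier G" using set_s subset_carrier by auto
  have stably_eq: "\<exists>i. u @ s_pow (Suc i) \<sim> v @ s_pow (Suc i)" if "same u v" for u v
  proof -
    have uv: "set u \<subseteq> E0" "set v \<subseteq> E0" using that by (auto simp: same_def)
    have W: "u @ s \<in> fs_words E" "v @ s \<in> fs_words E"
      using E0G(2) uv s_word by (simp_all add: fs_words_appendI)
    have "cls (u @ s) = cls (v @ s)"
      using that uv W E0G sG type[OF uv(1)] type[OF uv(2)]
      by (intro det) (simp_all add: same_def word_prod_append)
    then obtain i j where ij: "(u @ s) @ s_pow i \<sim> (v @ s) @ s_pow j"
      using W by (auto simp: cls_eq_iff stable_rel_def)
    from fs_eq_type[OF this] have "word_type G (s_pow i) = word_type G (s_pow j)"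
      using that by (simp add: same_def word_type_append)
    then have "i * size (word_type G s) = j * size (word_type G s)"
      using size_type_s_pow by metis
    then have "i = j" using pos by auto
    then show ?thesis using ij by (auto simp: s_pow_simps)
  qed
  \<comment> \<open>A word of length \<open>L\<close> has a letter occurring at least \<open>M\<close> times; among \<open>M\<close> letters of one conjugacy
    class some letter occurs at least \<open>N\<close> times.\<close>
  define N where "N = order G"
  define M where "M = card E0 * N"
  define L where "L = card E0 * M"
  have N: "0 < N" using fin by (simp add: N_def order_gt_0_iff_finite)
  have cE0: "0 < card E0" using E0 by (simp add: card_gt_0_iff)
  have NL: "N \<le> L" using cE0 by (simp add: L_def M_def)
  let ?W = "{w. set w \<subseteq> E0 \<and> length w \<le> L}"
  have "finite ({(u, v). same u v} \<inter> ?W \<times> ?W)"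
    using finite_lists_length_le[OF E0(3)] by (intro finite_Int disjI2 finite_cartesian_product)
  then obtain I where I: "\<forall>x\<in>{(u, v). same u v} \<inter> ?W \<times> ?W. fst x @ s_pow (Suc I) \<sim> snd x @ s_pow (Suc I)"
    using finite_uniform_bound[where Q = "\<lambda>x i. fst x @ s_pow (Suc i) \<sim> snd x @ s_pow (Suc i)"]
      stably_eq eq_after_power_mono by fastforce
  have short: "u @ s_pow (Suc I) \<sim> v @ s_pow (Suc I)" if "same u v" "length u \<le> L" for u v
  proof -
    have "(u, v) \<in> {(u, v). same u v} \<inter> ?W \<times> ?W"
      using that len[OF that(1)] by (simp add: same_def)
    from bspec[OF I this] show ?thesis by (simp only: fst_conv snd_conv)
  qed
  define t where "t = s_pow (Suc I)"
  have t: "t \<in> fs_words E" "set t \<subseteq> E"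
    using s_word set_s_pow[of I] set_s_pow[of "Suc I"] by (simp_all add: t_def s_pow_simps fs_words_appendI)
  have t_central: "u @ t \<sim> t @ u" if "set u \<subseteq> E" for u
    using fs_eq_sym[OF product_one_central[OF t(1) _ that]] prod_s_pow by (simp add: t_def)
  have pull: "\<exists>w'. w \<sim> replicate N g @ w' \<and> set w' \<subseteq> E0"
    if w: "set w \<subseteq> E0" "N \<le> count_list w g" for w g
  proof -
    have "w \<noteq> []" using w N by auto
    then have "w \<in> fs_words E0" using w by (simp add: fs_words_def)
    then obtain w' where w': "(w, replicate N g @ w') \<in> fs_rel G E0"
      using E0.pull_power_front[of w N g] w unfolding E0.fs_eq_def by blast
    then show ?thesis
      using fs_rel_mono[OF w' E0(1)] E0.fs_rel_words[OF w']
      by (auto simp: fs_eq_def fs_words_def)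
  qed
  have stable: "u @ t \<sim> v @ t" if "same u v" for u v
    using that
  proof (induction "length u" arbitrary: u v rule: less_induct)
    case less
    note uv = less.prems[unfolded same_def]
    show ?case
    proof (cases "length u \<le> L")
      case True
      then show ?thesis using short less.prems by (simp add: t_def)
    next
      case False
      then obtain g where g: "g \<in> E0" "M \<le> count_list u g"
        using pigeonhole_count_list[of u E0 M] uv E0 by (auto simp: L_def)
      let ?K = "\<lambda>x. conj_class G x = conj_class G g"
      have "length (filter ?K v) = length (filter ?K u)"
        using uv type by (metis count_mset_map)
      then have "card E0 * N \<le> length (filter ?K v)"
        using g count_list_le_length_filter[of ?K g u] by (simp add: M_def)
      moreover have "set (filter ?K v) \<subseteq> E0" using uv by auto
      ultimately obtain h where h: "N \<le> count_list (filter ?K v) h"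
        using pigeonhole_count_list[of "filter ?K v" E0 N] E0 by blast
      then have "h \<in> set (filter ?K v)" using N by (metis count_list_0_iff not_le)
      then have hK: "h \<in> E0" "conj_class G h = conj_class G g" using uv by auto
      have hv: "N \<le> count_list v h" using h count_list_filter_le[of ?K v h] by simp
      have "N \<le> M" using cE0 by (simp add: M_def)
      then obtain u' where u': "u \<sim> replicate N g @ u'" "set u' \<subseteq> E0"
        using pull[of u g] uv g by auto
      obtain v' where v': "v \<sim> replicate N h @ v'" "set v' \<subseteq> E0"
        using pull[of v h] uv hv by auto
      have rG: "set (replicate N x) \<subseteq> carrier G" "set (replicate N x) \<subseteq> E"
        "word_prod G (replicate N x) = \<one>" "set (replicate N x) \<subseteq> E0" if "x \<in> E0" for x
        using that E0(1) subset_carrier word_prod_replicate_order[of x] by (auto simp: N_def)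
      have types: "word_type G (replicate N g) = word_type G (replicate N h)"
        using type[OF rG(4)[OF g(1)]] type[OF rG(4)[OF hK(1)]] hK(2) by simp
      have "same (replicate N g) (replicate N h)"
        using rG[OF g(1)] rG[OF hK(1)] types by (simp add: same_def)
      then have gh: "replicate N g @ t \<sim> replicate N h @ t"
        using short NL by (simp add: t_def)
      have prods: "word_prod G (replicate N x @ w) = word_prod G w" if "x \<in> E0" "set w \<subseteq> E0" for x w
        using that rG[of x] E0G[of w] by (simp add: word_prod_append word_prod_closed)
      have "same u' v'"
        using uv fs_eq_prod[OF u'(1)] fs_eq_prod[OF v'(1)] fs_eq_type[OF u'(1)] fs_eq_type[OF v'(1)]
          prods[OF g(1) u'(2)] prods[OF hK(1) v'(2)] types u'(2) v'(2)
        by (simp add: same_def word_type_append)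
      moreover have "length u' < length u"
      proof -
        have "size (word_type G u) = N + size (word_type G u')"
          using fs_eq_type[OF u'(1)] type[OF rG(4)[OF g(1)]] by (simp add: word_type_append)
        then have "length u = N + length u'" using type[of u] type[of u'] uv u'(2) by simp
        then show ?thesis using N by simp
      qed
      ultimately have IH: "u' @ t \<sim> v' @ t" using less.hyps by blast
      note sub = rG(2)[OF g(1)] rG(2)[OF hK(1)] E0G(2)[OF v'(2)]
      \<comment> \<open>The central word \<open>t\<close> first serves the induction hypothesis, then is carried next to \<open>g\<^sup>N\<close>
        to turn it into \<open>h\<^sup>N\<close>.\<close>
      have "u @ t \<sim> replicate N g @ (u' @ t)"
        using fs_eq_append_right[OF u'(1) t(2)] by simp
      also have "\<dots> \<sim> replicate N g @ (v' @ t)" by (rule fs_eq_append_left[OF IH sub(1)])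
      also have "\<dots> \<sim> replicate N g @ (t @ v')"
        by (rule fs_eq_append_left[OF t_central[OF sub(3)] sub(1)])
      also have "\<dots> \<sim> replicate N h @ (t @ v')"
        using fs_eq_append_right[OF gh sub(3)] by simp
      also have "\<dots> \<sim> replicate N h @ (v' @ t)"
        by (rule fs_eq_append_left[OF fs_eq_sym[OF t_central[OF sub(3)]] sub(2)])
      also have "\<dots> \<sim> v @ t"
        using fs_eq_append_right[OF fs_eq_sym[OF v'(1)] t(2)] by simp
      finally show ?thesis .
    qed
  qed
  let ?f = "filter (\<lambda>g. g \<noteq> \<one>)"
  have f_prod: "word_prod G (?f w) = word_prod G w" if "set w \<subseteq> E" for w
    using that
  proof (induction w)
    case (Cons a w)
    then have "word_prod G w \<in> carrier G" using subset_carrier by (intro word_prod_closed) auto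
    then show ?case using Cons by simp
  qed simp
  have f_type: "word_type G (?f w) = word_type G w" for w
    by (induction w) (auto simp: word_type_def)
  have classes: "fs_rel G E `` {u @ t} = fs_rel G E `` {v @ t}"
    if uv: "u \<in> fs_words E" "v \<in> fs_words E"
      "word_prod G u = word_prod G v" "word_type G u = word_type G v" for u v
  proof -
    have sub: "set u \<subseteq> E" "set v \<subseteq> E" using uv by (auto simp: fs_words_def)
    have "same (?f u) (?f v)"
      using sub uv f_prod f_type by (auto simp: same_def E0_def)
    then have "u @ t \<sim> v @ t"
      using remove_ones[OF sub(1) t(1)] remove_ones[OF sub(2) t(1)] stable fs_eq_sym fs_eq_trans
      by blast
    then show ?thesis unfolding fs_eq_def by (rule equiv_class_eq[OF equiv_fs_rel])
  qed
  show ?thesis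
    unfolding stable_fact_semigroup_def fact_semigroup_def
  proof (intro bexI ballI impI)
    fix s1 s2 assume "s1 \<in> fs_words E // fs_rel G E" "s2 \<in> fs_words E // fs_rel G E"
    then obtain u v where uv: "u \<in> fs_words E" "s1 = fs_rel G E `` {u}"
      "v \<in> fs_words E" "s2 = fs_rel G E `` {v}" by (auto elim!: quotientE)
    assume "fs_alpha G s1 = fs_alpha G s2" "fs_type G s1 = fs_type G s2"
    then have "fs_rel G E `` {u @ t} = fs_rel G E `` {v @ t}"
      using uv by (intro classes) (simp_all add: fs_alpha_class fs_type_class)
    then show "fs_mult G E s1 (fs_rel G E `` {t}) = fs_mult G E s2 (fs_rel G E `` {t})"
      using uv t(1) by (simp add: fs_mult_class)
  qed (use t(1) in \<open>simp add: quotientI\<close>)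
qed

end


section \<open>Factorizations of permutations\<close>

theorem corollary1:
  fixes d :: nat and E C :: "(nat \<Rightarrow> nat) set" and \<sigma> :: "nat \<Rightarrow> nat"
  assumes "equipped_group (sym_group d) E"
    and "\<sigma> \<in> carrier (sym_group d)"
    and "C = conj_class (sym_group d) \<sigma>"
    and "C \<subseteq> E"
    and "\<not> evenperm \<sigma>"
    and "fixed_number d \<sigma> \<ge> 2"
  shows "stable_fact_semigroup (sym_group d) E"
proof -
  let ?G = "sym_group d" and ?S = "{1..d}"
  interpret equipped_group ?G E by (rule assms(1))
  have fin: "finite (carrier ?G)"
    using finite_permutations[of ?S] by (simp add: sym_group_def)
  have \<sigma>E: "\<sigma> \<in> E"
    using assms(2,3,4) by (auto simp: conj_class_def intro!: exI[of _ "\<one>\<^bsub>?G\<^esub>"])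
  obtain p q where pq: "p \<in> ?S" "q \<in> ?S" "p \<noteq> q" "\<sigma> p = p" "\<sigma> q = q"
    using assms(6) card_le_Suc0_iff_eq[of "{i \<in> ?S. \<sigma> i = i}"]
    unfolding fixed_number_def by (force simp: not_le[symmetric])
  have gen: "word_prod ?G ` fs_words E = carrier ?G"
  proof (rule normal_subgroup_with_odd_eq_sym_group)
    show "normal (word_prod ?G ` fs_words E) ?G"
      using \<sigma>E by (intro word_products_normal fin) auto
    have "word_prod ?G [\<sigma>] = \<sigma>" using assms(2) by simp
    then show "\<sigma> \<in> word_prod ?G ` fs_words E" using \<sigma>E by (metis fs_words_Cons empty_set empty_subsetI imageI)
  qed (use assms pq in auto)
  have tpq: "transposition p q \<in> carrier ?G" using pq by (simp add: sym_group_carrier permutes_swap_id)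
  have \<sigma>_conj: "transposition p q \<otimes>\<^bsub>?G\<^esub> \<sigma> \<otimes>\<^bsub>?G\<^esub> inv\<^bsub>?G\<^esub> (transposition p q) = \<sigma>"
  proof -
    have "transposition p q \<circ> \<sigma> = \<sigma> \<circ> transposition p q"
      using pq conj_transposition[of \<sigma> ?S p q] assms(2) permutes_inv_o(2)[of \<sigma> ?S]
      by (simp add: sym_group_carrier) (metis comp_assoc comp_id)
    then have "transposition p q \<otimes>\<^bsub>?G\<^esub> \<sigma> = \<sigma> \<otimes>\<^bsub>?G\<^esub> transposition p q" by (simp add: sym_group_mult)
    then have "transposition p q \<otimes>\<^bsub>?G\<^esub> \<sigma> \<otimes>\<^bsub>?G\<^esub> inv\<^bsub>?G\<^esub> (transposition p q) =
        \<sigma> \<otimes>\<^bsub>?G\<^esub> (transposition p q \<otimes>\<^bsub>?G\<^esub> inv\<^bsub>?G\<^esub> (transposition p q))"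
      using tpq assms(2) by (simp add: m_assoc del: sym_group_inv_equality)
    then show ?thesis using tpq assms(2) by (simp del: sym_group_inv_equality)
  qed
  from tpq obtain u where "u \<in> fs_words E" "word_prod ?G u = transposition p q" using gen by (metis imageE)
  then obtain \<tau> where \<tau>: "\<tau> \<in> fs_words E" "word_prod ?G \<tau> = transposition p q" "E \<subseteq> set \<tau>"
    using exists_word_containing_letters[OF fin] by metis
  have \<tau>\<tau>: "word_prod ?G (\<tau> @ \<tau>) = \<one>\<^bsub>?G\<^esub>"
    using \<tau> fs_words_carrier by (simp add: word_prod_append sym_group_mult sym_group_one)
  interpret stabilizing_word ?G E "\<tau> @ \<tau>"
  proof
    show "\<exists>u\<in>fs_words E. word_prod ?G u = a" if "a \<in> carrier ?G" for a
      using that gen by (metis imageE)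
  qed (use \<tau> \<tau>\<tau> in \<open>auto simp: fs_words_append\<close>)
  interpret perm_extension stable_group "fs_alpha ?G" ?S
  proof
    show "\<exists>x\<in>carrier stable_group. fs_alpha ?G x = h" if "h permutes ?S" for h
      using fs_alpha_surj that by (simp add: sym_group_carrier)
  qed (use \<alpha>.hom_closed \<alpha>.hom_mult kernel_central in \<open>auto simp: sym_group_carrier sym_group_mult sym_group_one\<close>)
  have \<sigma>_comm: "cls [\<sigma>] \<otimes>\<^bsub>stable_group\<^esub> cls \<tau> = cls \<tau> \<otimes>\<^bsub>stable_group\<^esub> cls [\<sigma>]"
  proof -
    have "fs_eq (\<tau> @ [\<sigma>]) ([\<sigma>] @ \<tau>)"
      using move_letter_left[of \<tau> \<sigma>] \<tau> \<sigma>E \<sigma>_conj by (simp add: fs_words_def)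
    then show ?thesis using \<tau>(1) \<sigma>E cls_eqI by (simp add: mult_cls)
  qed
  \<comment> \<open>With \<open>s = \<tau> \<tau>\<close> the class of \<open>\<tau>\<close> is an involution above \<open>(p q)\<close>, and \<open>\<sigma>\<close> is its odd commuting
    partner.\<close>
  interpret marked_perm_extension stable_group "fs_alpha ?G" ?S p q "cls \<tau>" "cls [\<sigma>]"
    using pq \<tau> \<sigma>E \<sigma>_comm assms(2,5)
    by unfold_locales (simp_all add: fs_alpha_cls mult_cls one_stable_group)
  obtain F where F: "\<And>h. h permutes ?S \<Longrightarrow> F h \<in> carrier stable_group"
    "\<And>h. h permutes ?S \<Longrightarrow> fs_alpha ?G (F h) = h"
    "\<And>g h. \<lbrakk>g permutes ?S; h permutes ?S\<rbrakk> \<Longrightarrow> F (g \<circ> h) = F g \<otimes>\<^bsub>stable_group\<^esub> F h"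
    using splitting by metis
  have F_hom: "F \<in> hom ?G stable_group"
    using F by (auto simp: hom_def sym_group_carrier sym_group_mult)
  have "cls u = cls v" if "u \<in> fs_words E" "v \<in> fs_words E" "word_prod ?G u = word_prod ?G v"
    "mset (map (conj_class ?G) u) = mset (map (conj_class ?G) v)" for u v
  proof -
    have "word_prod stable_group (map (\<lambda>g. cls [g]) u) = word_prod stable_group (map (\<lambda>g. cls [g]) v)"
    proof (rule \<alpha>.word_prod_determined_by_type[OF kernel_central F_hom _ subset_carrier])
      show "fs_alpha ?G (F g) = g" if "g \<in> carrier ?G" for g
        using F(2) that by (simp add: sym_group_carrier)
      show "fs_alpha ?G (cls [g]) = g" if "g \<in> E" for g
        using that E_carrier by (simp add: fs_alpha_cls)
    qed (use that conj_letter in \<open>auto simp: fs_words_def\<close>)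
    then show ?thesis using that word_prod_cls by simp
  qed
  moreover have "\<sigma> \<noteq> \<one>\<^bsub>?G\<^esub>" using assms(5) by (auto simp: sym_group_one)
  ultimately show ?thesis using stable_if_group_determined[OF fin \<sigma>E] by blast
qed

end
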